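(* Let $q(x,y,z)=ax^2+by^2+cz^2+2ryz+2sxz+2txy$ be an Eisenstein reduced positive definite ternary quadratic form with $a,b,c,r,s,t\in\mathbb{Z}$, and put $u=|\mathrm{Aut}^+(q)|$. If $3\mid u$ and $u>6$, then: (i) $u=12$ if and only if ($a=b=-2t$ and $r=s=0$) or ($a\neq b$, $b=c=-2r$ and $s=t=0$). (ii) $u=24$ if and only if ($a=b=c=\kappa r=\kappa s=\kappa t$ with $\kappa=2$ or $\kappa=-3$) or ($a=b=c$ and $r=s=t=0$).
   Context: $\mathrm{Aut}^+(q)$ is the group of $\alpha\in\mathrm{GL}_3(\mathbb{Z})$ with $q\circ\alpha=q$ and $\det\alpha=1$. A positive definite form $q=ax^2+by^2+cz^2+2ryz+2sxz+2txy$ is Eisenstein reduced if, with $\epsilon=a+b+2r+2s+2t$, the following hold: (1) $r,s,t$ are all positive or all non-positive; (2) $a\le b\le c$ and $\epsilon\ge 0$; (3) $a\ge|2s|$, $a\ge|2t|$, $b\ge|2r|$; (4) if $a=b$ then $|r|\le|s|$; if $b=c$ then $|s|\le|t|$; if $\epsilon=0$ then $a+2s+t\le 0$; (5) in the case $r,s,t\le 0$: if $a=-2t$ then $s=0$; if $a=-2s$ then $t=0$; if $b=-2r$ then $t=0$; (6) in the case $r,s,t>0$: if $a=2t$ then $s\le 2r$; if $a=2s$ then $t\le 2r$; if $b=2r$ then $t\le 2s$. *)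

theory Defs
  imports "HOL-Analysis.Analysis"
begin

definition ternary_form ::
    "'a \<Rightarrow> 'a \<Rightarrow> 'a \<Rightarrow> 'a \<Rightarrow> 'a \<Rightarrow> 'a \<Rightarrow> 'a ^ 3 \<Rightarrow> 'a :: comm_ring_1" where
  "ternary_form a b c r s t v =
     a * (v $ 1)\<^sup>2 + b * (v $ 2)\<^sup>2 + c * (v $ 3)\<^sup>2
     + 2 * r * (v $ 2) * (v $ 3) + 2 * s * (v $ 1) * (v $ 3) + 2 * t * (v $ 1) * (v $ 2)"

definition positive_definite :: "(real ^ 3 \<Rightarrow> real) \<Rightarrow> bool" where
  "positive_definite q \<longleftrightarrow> (\<forall>v. v \<noteq> 0 \<longrightarrow> q v > 0)"

text \<open>
  A form is given here by its values on integer vectors. For a form with integer coefficients,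
  equality of these functions is the same as equality of polynomials. Over the integers,
  \<^const>\<open>invertible\<close> means having an inverse with integer entries, so the first
  conjunct below is membership in the integral general linear group.
\<close>

definition Aut_plus :: "(int ^ 3 \<Rightarrow> int) \<Rightarrow> (int ^ 3 ^ 3) set" where
  "Aut_plus q = {A. invertible A \<and> q \<circ> (\<lambda>v. A *v v) = q \<and> det A = 1}"

text \<open>
  Positive definiteness is not included in the following predicate on coefficients; it is a
  separate hypothesis on the form.
\<close>

definition eisenstein_reduced ::
    "'a \<Rightarrow> 'a \<Rightarrow> 'a \<Rightarrow> 'a \<Rightarrow> 'a \<Rightarrow> 'a :: linordered_idom \<Rightarrow> bool" where
  "eisenstein_reduced a b c r s t \<longleftrightarrow>
    (let \<epsilon> = a + b + 2 * r + 2 * s + 2 * t in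
      (r > 0 \<and> s > 0 \<and> t > 0 \<or> r \<le> 0 \<and> s \<le> 0 \<and> t \<le> 0) \<and>
      (a \<le> b \<and> b \<le> c \<and> \<epsilon> \<ge> 0) \<and>
      (a \<ge> \<bar>2 * s\<bar> \<and> a \<ge> \<bar>2 * t\<bar> \<and> b \<ge> \<bar>2 * r\<bar>) \<and>
      ((a = b \<longrightarrow> \<bar>r\<bar> \<le> \<bar>s\<bar>) \<and> (b = c \<longrightarrow> \<bar>s\<bar> \<le> \<bar>t\<bar>) \<and> (\<epsilon> = 0 \<longrightarrow> a + 2 * s + t \<le> 0)) \<and>
      (r \<le> 0 \<and> s \<le> 0 \<and> t \<le> 0 \<longrightarrow>
        (a = - 2 * t \<longrightarrow> s = 0) \<and> (a = - 2 * s \<longrightarrow> t = 0) \<and> (b = - 2 * r \<longrightarrow> t = 0)) \<and>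
      (r > 0 \<and> s > 0 \<and> t > 0 \<longrightarrow>
        (a = 2 * t \<longrightarrow> s \<le> 2 * r) \<and> (a = 2 * s \<longrightarrow> t \<le> 2 * r) \<and> (b = 2 * r \<longrightarrow> t \<le> 2 * s)))"

end

theory Submission
  imports Defs "HOL-Algebra.Sylow" "HOL-Algebra.Multiplicative_Group"
begin

text \<open>
  An automorph is recorded by the triple of its columns, that is, by the images of the basis
  vectors \<open>e1\<close>, \<open>e2\<close>, \<open>e3\<close>; the conditions on it say that these images have the same Gram
  matrix as the basis and that the determinant is \<open>1\<close>. The divisibility of \<open>u\<close> by \<open>3\<close> enters
  through Sylow's theorem, which gives an automorph \<open>A\<close> of order three (\<open>order_three_isom\<close>).

  A reduced form is a sum of nonnegative multiples of the squares of \<open>x\<close>, \<open>y\<close>, \<open>z\<close> and of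
  \<open>y \<plusminus> z\<close>, \<open>x \<plusminus> z\<close>, \<open>x \<plusminus> y\<close>, with the sign \<open>+\<close> if \<open>r, s, t > 0\<close> and \<open>-\<close> otherwise. Truncating
  all coordinates to an interval \<open>[-n, n]\<close> therefore does not increase the form
  (\<open>Q_clamp_le\<close>). With \<open>n = 1\<close> and \<open>n = 2\<close> this leaves finitely many vectors to inspect and
  shows which entries of an automorph vanish or lie in \<open>{-1, 0, 1}\<close> (\<open>isom_entries\<close>).

  Hence the automorph \<open>A\<close> of order three has one of a few shapes, and each shape imposes linear
  equations on the coefficients. If \<open>a < b\<close>, then \<open>A\<close> fixes \<open>e1\<close>; the form is either the
  hexagonal one with \<open>b = c = -2r\<close>, \<open>s = t = 0\<close>, or the rhombohedral one with \<open>a = -3s = -3t\<close>,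
  \<open>3 (b + 2r) = a\<close> (\<open>order_three_axis_e1\<close>). If \<open>a = b < c\<close>, then \<open>A\<close> preserves the plane of \<open>e1\<close>
  and \<open>e2\<close>; the form is either hexagonal with \<open>a = -2t\<close>, \<open>r = s = 0\<close>, or rhombohedral with
  \<open>a = 2r = 2s = 2t\<close> (\<open>order_three_axis_e3\<close>). If \<open>a = b = c\<close>, then either \<open>r = s = t\<close> or again
  \<open>a = -2t\<close>, \<open>r = s = 0\<close> (\<open>order_three_equal_diagonal\<close>).

  The proof ends by counting. The hexagonal forms have exactly \<open>12\<close> automorphs. The forms with
  \<open>a = b = c\<close> and \<open>r = s = t\<close> have exactly \<open>24\<close> if \<open>r = 0\<close>, \<open>a = 2r\<close> or \<open>a = -3r\<close> (the primitive,
  face-centred and body-centred cubic lattices) and otherwise at most \<open>6\<close>. The remaining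
  rhombohedral forms have at most \<open>6\<close> as well, and \<open>u > 6\<close> excludes them.
\<close>

section \<open>Automorphs as triples of columns\<close>

text \<open>Integer vectors are triples of integers, so that finite searches over them can be evaluated.\<close>

type_synonym ivec = "int \<times> int \<times> int"

text \<open>The symmetric bilinear form with Gram matrix having diagonal \<open>a, b, c\<close> and off-diagonal entries
  \<open>r\<close>, \<open>s\<close>, \<open>t\<close> at the positions \<open>(2, 3)\<close>, \<open>(1, 3)\<close>, \<open>(1, 2)\<close>; its diagonal is the ternary form.
  The norm of a vector is its product with itself.\<close>

fun bil :: "int \<Rightarrow> int \<Rightarrow> int \<Rightarrow> int \<Rightarrow> int \<Rightarrow> int \<Rightarrow> ivec \<Rightarrow> ivec \<Rightarrow> int" where
  "bil a b c r s t (x, y, z) (x', y', z') =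
     a * x * x' + b * y * y' + c * z * z'
     + r * (y * z' + z * y') + s * (x * z' + z * x') + t * (x * y' + y * x')"

text \<open>The determinant of the matrix with the given columns.\<close>

fun det_cols :: "ivec \<times> ivec \<times> ivec \<Rightarrow> int" where
  "det_cols ((x1, y1, z1), (x2, y2, z2), (x3, y3, z3)) =
     x1 * (y2 * z3 - y3 * z2) - x2 * (y1 * z3 - y3 * z1) + x3 * (y1 * z2 - y2 * z1)"

text \<open>The vectors \<open>u\<close>, \<open>v\<close>, \<open>w\<close> are the columns of an automorph of determinant \<open>1\<close>: their Gram matrix
  is that of the form.\<close>

fun is_isom :: "int \<Rightarrow> int \<Rightarrow> int \<Rightarrow> int \<Rightarrow> int \<Rightarrow> int \<Rightarrow> ivec \<times> ivec \<times> ivec \<Rightarrow> bool" where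
  "is_isom a b c r s t (u, v, w) \<longleftrightarrow>
     bil a b c r s t u u = a \<and> bil a b c r s t v v = b \<and> bil a b c r s t w w = c \<and>
     bil a b c r s t u v = t \<and> bil a b c r s t u w = s \<and> bil a b c r s t v w = r \<and>
     det_cols (u, v, w) = 1"

text \<open>The product of the matrix with the given columns and a vector.\<close>

fun apply_cols :: "ivec \<times> ivec \<times> ivec \<Rightarrow> ivec \<Rightarrow> ivec" where
  "apply_cols ((x1, y1, z1), (x2, y2, z2), (x3, y3, z3)) (x, y, z) =
     (x * x1 + y * x2 + z * x3, x * y1 + y * y2 + z * y3, x * z1 + y * z2 + z * z3)"

text \<open>The matrix \<open>A\<close> with the given columns is not the identity, and \<open>A\<^sup>3 = 1\<close>: applying \<open>A\<close> twice to
  its own columns gives the basis vectors.\<close>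

fun order_three :: "ivec \<times> ivec \<times> ivec \<Rightarrow> bool" where
  "order_three (u, v, w) \<longleftrightarrow> (u, v, w) \<noteq> ((1, 0, 0), (0, 1, 0), (0, 0, 1)) \<and>
     apply_cols (u, v, w) (apply_cols (u, v, w) u) = (1, 0, 0) \<and>
     apply_cols (u, v, w) (apply_cols (u, v, w) v) = (0, 1, 0) \<and>
     apply_cols (u, v, w) (apply_cols (u, v, w) w) = (0, 0, 1)"

text \<open>The columns of a matrix; note that \<open>A $ i $ j\<close> is the entry in row \<open>i\<close> and column \<open>j\<close>.\<close>

definition cols :: "int ^ 3 ^ 3 \<Rightarrow> ivec \<times> ivec \<times> ivec" where
  "cols A = ((A $ 1 $ 1, A $ 2 $ 1, A $ 3 $ 1), (A $ 1 $ 2, A $ 2 $ 2, A $ 3 $ 2),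
     (A $ 1 $ 3, A $ 2 $ 3, A $ 3 $ 3))"

lemma inj_cols: "inj cols"
  by (auto simp: inj_def cols_def vec_eq_iff forall_3)

lemma surj_cols: "surj cols"
proof -
  have "\<exists>A. m = cols A" for m
  proof -
    obtain x1 y1 z1 x2 y2 z2 x3 y3 z3
      where m: "m = ((x1, y1, z1), (x2, y2, z2), (x3, y3, z3))" by (cases m) auto
    have "m = cols (vector [vector [x1, x2, x3], vector [y1, y2, y3], vector [z1, z2, z3]])"
      by (simp add: m cols_def)
    then show ?thesis ..
  qed
  then show ?thesis by (simp add: surj_def)
qed

lemma det_eq_det_cols: "det A = det_cols (cols A)"
  by (simp add: det_3 cols_def algebra_simps)

text \<open>The adjugate is an integral inverse.\<close>

lemma invertible_if_det_1:
  fixes A :: "int ^ 3 ^ 3"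
  assumes "det A = 1"
  shows "invertible A"
proof -
  define adj where "adj =
    (vector [vector [A$2$2 * A$3$3 - A$2$3 * A$3$2, A$1$3 * A$3$2 - A$1$2 * A$3$3, A$1$2 * A$2$3 - A$1$3 * A$2$2],
             vector [A$2$3 * A$3$1 - A$2$1 * A$3$3, A$1$1 * A$3$3 - A$1$3 * A$3$1, A$1$3 * A$2$1 - A$1$1 * A$2$3],
             vector [A$2$1 * A$3$2 - A$2$2 * A$3$1, A$1$2 * A$3$1 - A$1$1 * A$3$2, A$1$1 * A$2$2 - A$1$2 * A$2$1]]
      :: int ^ 3 ^ 3)"
  have "A ** adj = mat 1 \<and> adj ** A = mat 1"
    using assms
    by (simp add: vec_eq_iff forall_3 matrix_matrix_mult_def sum_3 adj_def mat_def det_3 algebra_simps)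
  then show ?thesis by (auto simp: invertible_def)
qed

lemma ternary_form_mult:
  "ternary_form a b c r s t (A *v x) =
     (case cols A of (u, v, w) \<Rightarrow>
       ternary_form (bil a b c r s t u u) (bil a b c r s t v v) (bil a b c r s t w w)
         (bil a b c r s t v w) (bil a b c r s t u w) (bil a b c r s t u v) x)"
  by (simp add: ternary_form_def matrix_vector_mult_def sum_3 cols_def power2_eq_square algebra_simps)

lemma ternary_form_eq_iff:
  fixes a b c r s t :: int
  shows "ternary_form a b c r s t = ternary_form a' b' c' r' s' t' \<longleftrightarrow>
    a = a' \<and> b = b' \<and> c = c' \<and> r = r' \<and> s = s' \<and> t = t'"
proof
  assume eq: "ternary_form a b c r s t = ternary_form a' b' c' r' s' t'"
  have "ternary_form a b c r s t (vector [x, y, z]) = ternary_form a' b' c' r' s' t' (vector [x, y, z])"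
    for x y z by (simp add: eq)
  from this[of 1 0 0] this[of 0 1 0] this[of 0 0 1] this[of 0 1 1] this[of 1 0 1] this[of 1 1 0]
  show "a = a' \<and> b = b' \<and> c = c' \<and> r = r' \<and> s = s' \<and> t = t'"
    by (simp add: ternary_form_def)
qed auto

lemma Aut_plus_iff: "A \<in> Aut_plus (ternary_form a b c r s t) \<longleftrightarrow> is_isom a b c r s t (cols A)"
proof -
  obtain u v w where m: "cols A = (u, v, w)" by (cases "cols A") auto
  have "ternary_form a b c r s t \<circ> (\<lambda>x. A *v x) =
      ternary_form (bil a b c r s t u u) (bil a b c r s t v v) (bil a b c r s t w w)
         (bil a b c r s t v w) (bil a b c r s t u w) (bil a b c r s t u v)"
    by (rule ext) (simp add: ternary_form_mult m)
  then show ?thesis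
    using invertible_if_det_1[of A]
    by (auto simp: Aut_plus_def m ternary_form_eq_iff det_eq_det_cols simp del: det_cols.simps)
qed

lemma card_Aut_plus: "card (Aut_plus (ternary_form a b c r s t)) = card {m. is_isom a b c r s t m}"
proof -
  have "Aut_plus (ternary_form a b c r s t) = cols -` {m. is_isom a b c r s t m}"
    by (auto simp: Aut_plus_iff simp del: is_isom.simps)
  then show ?thesis
    using card_vimage_inj[OF inj_cols, of "{m. is_isom a b c r s t m}"] surj_cols by simp
qed

section \<open>An automorph of order three\<close>

text \<open>The group of automorphs of determinant \<open>1\<close>, for an arbitrary function on integer vectors.\<close>

definition Aut_group :: "(int ^ 3 \<Rightarrow> int) \<Rightarrow> (int ^ 3 ^ 3) monoid" where
  "Aut_group q = \<lparr>carrier = Aut_plus q, mult = (**), one = mat 1\<rparr>"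

lemma group_Aut_plus: "group (Aut_group q)"
proof (rule groupI)
  fix A B assume "A \<in> carrier (Aut_group q)" "B \<in> carrier (Aut_group q)"
  then have A: "invertible A" "q (A *v v) = q v" "det A = 1"
    and B: "invertible B" "q (B *v v) = q v" "det B = 1" for v
    by (auto simp: Aut_group_def Aut_plus_def fun_eq_iff)
  have "q ((A ** B) *v v) = q v" for v
    by (metis A(2) B(2) matrix_vector_mul_assoc)
  then show "A \<otimes>\<^bsub>Aut_group q\<^esub> B \<in> carrier (Aut_group q)"
    using A B by (auto simp: Aut_group_def Aut_plus_def fun_eq_iff det_mul invertible_mult)
next
  show "\<one>\<^bsub>Aut_group q\<^esub> \<in> carrier (Aut_group q)"
    by (auto simp: Aut_group_def Aut_plus_def fun_eq_iff invertible_if_det_1)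
next
  fix A assume "A \<in> carrier (Aut_group q)"
  then have A: "invertible A" "q (A *v v) = q v" "det A = 1" for v
    by (auto simp: Aut_group_def Aut_plus_def fun_eq_iff)
  then obtain B where B: "A ** B = mat 1" "B ** A = mat 1" by (auto simp: invertible_def)
  have "q (B *v v) = q v" for v
    by (metis A(2) B(1) matrix_vector_mul_assoc matrix_vector_mul_lid)
  moreover have "det B = 1"
    using B(1) A(3) by (metis det_I det_mul mult_1)
  ultimately have "B \<in> Aut_plus q"
    by (auto simp: Aut_plus_def fun_eq_iff invertible_if_det_1)
  then show "\<exists>B\<in>carrier (Aut_group q). B \<otimes>\<^bsub>Aut_group q\<^esub> A = \<one>\<^bsub>Aut_group q\<^esub>"
    using B(2) by (auto simp: Aut_group_def)
qed (auto simp: Aut_group_def matrix_mul_assoc)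

lemma order_three_element:
  assumes "3 dvd card (Aut_plus q)" and "card (Aut_plus q) > 0"
  obtains A where "A \<in> Aut_plus q" and "A \<noteq> mat 1" and "A ** A ** A = mat 1"
proof -
  interpret group "Aut_group q" by (rule group_Aut_plus)
  obtain m where m: "card (Aut_plus q) = 3 ^ 1 * m" using assms(1) by (auto elim: dvdE)
  have fin: "finite (Aut_plus q)" using assms(2) card_ge_0_finite by blast
  obtain H where H: "subgroup H (Aut_group q)" and card_H: "card H = 3"
    using sylow_thm[OF _ is_group, of 3 1 m] m fin
    by (auto simp: order_def Aut_group_def)
  have "\<not> H \<subseteq> {mat 1}"
    using card_mono[of "{mat 1 :: int ^ 3 ^ 3}" H] card_H by auto
  then obtain A where A: "A \<in> H" "A \<noteq> mat 1" by blast
  interpret H: group "Aut_group q\<lparr>carrier := H\<rparr>"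
    using H by (rule subgroup_imp_group)
  have "A [^]\<^bsub>Aut_group q\<lparr>carrier := H\<rparr>\<^esub> (3::nat) = \<one>\<^bsub>Aut_group q\<^esub>"
    using H.pow_order_eq_1[of A] A(1) card_H by (simp add: order_def)
  then have "A ** A ** A = mat 1"
    by (simp add: Aut_group_def nat_pow_def numeral_3_eq_3)
  moreover have "A \<in> Aut_plus q"
    using subgroup.subset[OF H] A(1) by (auto simp: Aut_group_def)
  ultimately show ?thesis using that A(2) by blast
qed

lemma order_three_isom:
  assumes "3 dvd card {m. is_isom a b c r s t m}" and "card {m. is_isom a b c r s t m} > 0"
  obtains m where "is_isom a b c r s t m" and "order_three m"
proof -
  obtain A where A: "A \<in> Aut_plus (ternary_form a b c r s t)" "A \<noteq> mat 1" "A ** A ** A = mat 1"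
    using order_three_element[of "ternary_form a b c r s t"] assms by (metis card_Aut_plus)
  have "A ** (A ** A) = mat 1" using A(3) by (simp add: matrix_mul_assoc)
  then have "order_three (cols A)"
    using A(2)
    by (auto simp: cols_def vec_eq_iff forall_3 mat_def matrix_matrix_mult_def sum_3 algebra_simps)
  then show ?thesis using that A(1) Aut_plus_iff by blast
qed

section \<open>Short vectors of a reduced form\<close>

text \<open>Truncation of an integer to the interval \<open>[-n, n]\<close>.\<close>

definition clamp :: "int \<Rightarrow> int \<Rightarrow> int" where
  "clamp n x = max (- n) (min n x)"

lemma clamp_1: "clamp 1 x \<in> {-1, 0, 1}" "x \<noteq> 0 \<Longrightarrow> clamp 1 x \<in> {-1, 1}"
  and clamp_2: "clamp 2 x \<in> {-2, -1, 0, 1, 2}" "\<bar>x\<bar> \<ge> 2 \<Longrightarrow> clamp 2 x \<in> {-2, 2}"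
  by (auto simp: clamp_def)

text \<open>A reduced form with integer coefficients. The condition \<open>a > 0\<close> is all that is used of positive
  definiteness.\<close>

locale reduced_form =
  fixes a b c r s t :: int
  assumes a_pos: "a > 0" and reduced: "eisenstein_reduced a b c r s t"
begin

abbreviation Q :: "int \<Rightarrow> int \<Rightarrow> int \<Rightarrow> int" where
  "Q x y z \<equiv> bil a b c r s t (x, y, z) (x, y, z)"

text \<open>The inequalities among the conditions of reduction. Further conditions, which single out one
  form when some inequality is an equality, are collected in \<open>boundary\<close>.\<close>

lemma basic:
  "a \<le> b" "b \<le> c" "a + b + 2 * r + 2 * s + 2 * t \<ge> 0"
  "2 * s \<le> a" "- a \<le> 2 * s" "2 * t \<le> a" "- a \<le> 2 * t" "2 * r \<le> b" "- b \<le> 2 * r"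
  "r > 0 \<and> s > 0 \<and> t > 0 \<or> r \<le> 0 \<and> s \<le> 0 \<and> t \<le> 0"
proof -
  have "a \<le> b \<and> b \<le> c \<and> a + b + 2 * r + 2 * s + 2 * t \<ge> 0"
    and abs: "\<bar>2 * s\<bar> \<le> a \<and> \<bar>2 * t\<bar> \<le> a \<and> \<bar>2 * r\<bar> \<le> b"
    and sgn: "r > 0 \<and> s > 0 \<and> t > 0 \<or> r \<le> 0 \<and> s \<le> 0 \<and> t \<le> 0"
    using reduced unfolding eisenstein_reduced_def Let_def by blast+
  then show "a \<le> b" "b \<le> c" "a + b + 2 * r + 2 * s + 2 * t \<ge> 0" by simp_all
  show "2 * s \<le> a" "- a \<le> 2 * s" "2 * t \<le> a" "- a \<le> 2 * t" "2 * r \<le> b" "- b \<le> 2 * r"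
    using abs by (simp_all add: abs_le_iff)
  show "r > 0 \<and> s > 0 \<and> t > 0 \<or> r \<le> 0 \<and> s \<le> 0 \<and> t \<le> 0" by (rule sgn)
qed

lemma sign_cases:
  obtains (pos) "r > 0" "s > 0" "t > 0" | (nonpos) "r \<le> 0" "s \<le> 0" "t \<le> 0"
  using basic(10) by blast

lemma boundary:
  "a = b \<Longrightarrow> \<bar>r\<bar> \<le> \<bar>s\<bar>"
  "b = c \<Longrightarrow> \<bar>s\<bar> \<le> \<bar>t\<bar>"
  "r \<le> 0 \<Longrightarrow> s \<le> 0 \<Longrightarrow> t \<le> 0 \<Longrightarrow> a = - 2 * t \<Longrightarrow> s = 0"
  "r \<le> 0 \<Longrightarrow> s \<le> 0 \<Longrightarrow> t \<le> 0 \<Longrightarrow> b = - 2 * r \<Longrightarrow> t = 0"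
  "r > 0 \<Longrightarrow> s > 0 \<Longrightarrow> t > 0 \<Longrightarrow> a = 2 * t \<Longrightarrow> s \<le> 2 * r"
  using reduced unfolding eisenstein_reduced_def Let_def by blast+

text \<open>Truncation is odd and does not increase distances, so it increases none of the six squares in
  the decomposition.\<close>

lemma Q_clamp_le:
  assumes "n \<ge> 0"
  shows "Q (clamp n x) (clamp n y) (clamp n z) \<le> Q x y z"
proof -
  define x' y' z' where "x' = clamp n x" and "y' = clamp n y" and "z' = clamp n z"
  have sq: "x'\<^sup>2 \<le> x\<^sup>2" "y'\<^sup>2 \<le> y\<^sup>2" "z'\<^sup>2 \<le> z\<^sup>2"
    and minus: "(y' - z')\<^sup>2 \<le> (y - z)\<^sup>2" "(x' - z')\<^sup>2 \<le> (x - z)\<^sup>2" "(x' - y')\<^sup>2 \<le> (x - y)\<^sup>2"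
    and plus: "(y' + z')\<^sup>2 \<le> (y + z)\<^sup>2" "(x' + z')\<^sup>2 \<le> (x + z)\<^sup>2" "(x' + y')\<^sup>2 \<le> (x + y)\<^sup>2"
    using assms unfolding abs_le_square_iff[symmetric] x'_def y'_def z'_def clamp_def by auto
  show ?thesis
  proof (cases rule: sign_cases)
    case sgn: pos
    have Q: "Q x y z = (a - s - t) * x\<^sup>2 + (b - r - t) * y\<^sup>2 + (c - r - s) * z\<^sup>2
        + r * (y + z)\<^sup>2 + s * (x + z)\<^sup>2 + t * (x + y)\<^sup>2" for x y z
      by (simp add: power2_eq_square algebra_simps)
    have "a - s - t \<ge> 0" "b - r - t \<ge> 0" "c - r - s \<ge> 0" using basic by auto
    then have "Q x' y' z' \<le> Q x y z"
      unfolding Q using sgn by (intro add_mono mult_left_mono sq plus) auto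
    then show ?thesis by (simp add: x'_def y'_def z'_def)
  next
    case sgn: nonpos
    have Q: "Q x y z = (a + s + t) * x\<^sup>2 + (b + r + t) * y\<^sup>2 + (c + r + s) * z\<^sup>2
        + (- r) * (y - z)\<^sup>2 + (- s) * (x - z)\<^sup>2 + (- t) * (x - y)\<^sup>2" for x y z
      by (simp add: power2_eq_square algebra_simps)
    have "a + s + t \<ge> 0" "b + r + t \<ge> 0" "c + r + s \<ge> 0" using basic by auto
    then have "Q x' y' z' \<le> Q x y z"
      unfolding Q using sgn by (intro add_mono mult_left_mono sq minus) auto
    then show ?thesis by (simp add: x'_def y'_def z'_def)
  qed
qed

text \<open>Reducedness makes \<open>a\<close>, \<open>b\<close>, \<open>c\<close> the successive minima. By truncation it suffices to look at vectors
  with coordinates in \<open>{-1, 0, 1}\<close>, and on each of them the claim is linear in the coefficients.\<close>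

lemma Q_ge:
  shows "y \<noteq> 0 \<Longrightarrow> Q x y z \<ge> b" and "z \<noteq> 0 \<Longrightarrow> Q x y z \<ge> c"
proof -
  have *: "Q (clamp 1 x) (clamp 1 y) (clamp 1 z) \<le> Q x y z" by (rule Q_clamp_le) simp
  have box_y: "Q X Y Z \<ge> b" if "X \<in> {-1, 0, 1}" "Y \<in> {-1, 1}" "Z \<in> {-1, 0, 1}" for X Y Z
  proof (cases rule: sign_cases)
    case sgn: pos
    show ?thesis
      using that
      by (elim insertE emptyE; hypsubst; (simp (no_asm))?; use basic(1-9) sgn a_pos in linarith)
  next
    case sgn: nonpos
    show ?thesis
      using that
      by (elim insertE emptyE; hypsubst; (simp (no_asm))?; use basic(1-9) sgn a_pos in linarith)
  qed
  show "Q x y z \<ge> b" if "y \<noteq> 0"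
    using * box_y[OF clamp_1(1)[of x] clamp_1(2)[OF that] clamp_1(1)[of z]] by linarith
  have box_z: "Q X Y Z \<ge> c" if "X \<in> {-1, 0, 1}" "Y \<in> {-1, 0, 1}" "Z \<in> {-1, 1}" for X Y Z
  proof (cases rule: sign_cases)
    case sgn: pos
    show ?thesis
      using that
      by (elim insertE emptyE; hypsubst; (simp (no_asm))?; use basic(1-9) sgn a_pos in linarith)
  next
    case sgn: nonpos
    show ?thesis
      using that
      by (elim insertE emptyE; hypsubst; (simp (no_asm))?; use basic(1-9) sgn a_pos in linarith)
  qed
  show "Q x y z \<ge> c" if "z \<noteq> 0"
    using * box_z[OF clamp_1(1)[of x] clamp_1(1)[of y] clamp_1(2)[OF that]] by linarith
qed

text \<open>A second truncation, to \<open>[-2, 2]\<close>, bounds the coordinates of short vectors.\<close>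

lemma Q_gt:
  shows "\<bar>x\<bar> \<ge> 2 \<Longrightarrow> Q x y z > a" and "\<bar>y\<bar> \<ge> 2 \<Longrightarrow> Q x y z > b" and "\<bar>z\<bar> \<ge> 2 \<Longrightarrow> Q x y z > c"
proof -
  have *: "Q (clamp 2 x) (clamp 2 y) (clamp 2 z) \<le> Q x y z" by (rule Q_clamp_le) simp
  have box_x: "Q X Y Z > a" if "X \<in> {-2, 2}" "Y \<in> {-2, -1, 0, 1, 2}" "Z \<in> {-2, -1, 0, 1, 2}" for X Y Z
  proof (cases rule: sign_cases)
    case sgn: pos
    show ?thesis
      using that
      by (elim insertE emptyE; hypsubst; (simp (no_asm))?; use basic(1-9) sgn a_pos in linarith)
  next
    case sgn: nonpos
    show ?thesis
      using that
      by (elim insertE emptyE; hypsubst; (simp (no_asm))?; use basic(1-9) sgn a_pos in linarith)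
  qed
  show "Q x y z > a" if "\<bar>x\<bar> \<ge> 2"
    using * box_x[OF clamp_2(2)[OF that] clamp_2(1)[of y] clamp_2(1)[of z]] by linarith
  have box_y: "Q X Y Z > b" if "X \<in> {-2, -1, 0, 1, 2}" "Y \<in> {-2, 2}" "Z \<in> {-2, -1, 0, 1, 2}" for X Y Z
  proof (cases rule: sign_cases)
    case sgn: pos
    show ?thesis
      using that
      by (elim insertE emptyE; hypsubst; (simp (no_asm))?; use basic(1-9) sgn a_pos in linarith)
  next
    case sgn: nonpos
    show ?thesis
      using that
      by (elim insertE emptyE; hypsubst; (simp (no_asm))?; use basic(1-9) sgn a_pos in linarith)
  qed
  show "Q x y z > b" if "\<bar>y\<bar> \<ge> 2"
    using * box_y[OF clamp_2(1)[of x] clamp_2(2)[OF that] clamp_2(1)[of z]] by linarith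
  have box_z: "Q X Y Z > c" if "X \<in> {-2, -1, 0, 1, 2}" "Y \<in> {-2, -1, 0, 1, 2}" "Z \<in> {-2, 2}" for X Y Z
  proof (cases rule: sign_cases)
    case sgn: pos
    show ?thesis
      using that
      by (elim insertE emptyE; hypsubst; (simp (no_asm))?; use basic(1-9) sgn a_pos in linarith)
  next
    case sgn: nonpos
    show ?thesis
      using that
      by (elim insertE emptyE; hypsubst; (simp (no_asm))?; use basic(1-9) sgn a_pos in linarith)
  qed
  show "Q x y z > c" if "\<bar>z\<bar> \<ge> 2"
    using * box_z[OF clamp_2(1)[of x] clamp_2(1)[of y] clamp_2(2)[OF that]] by linarith
qed

lemma small_coordinate:
  "Q x y z \<le> a \<Longrightarrow> x \<in> {-1, 0, 1}" "Q x y z \<le> b \<Longrightarrow> y \<in> {-1, 0, 1}" "Q x y z \<le> c \<Longrightarrow> z \<in> {-1, 0, 1}"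
  "Q x y z < b \<Longrightarrow> y = 0" "Q x y z < c \<Longrightarrow> z = 0"
proof -
  have trit: "k \<in> {-1, 0, 1}" if "\<not> \<bar>k\<bar> \<ge> 2" for k :: int
    using that by auto
  show "Q x y z \<le> a \<Longrightarrow> x \<in> {-1, 0, 1}" "Q x y z \<le> b \<Longrightarrow> y \<in> {-1, 0, 1}" "Q x y z \<le> c \<Longrightarrow> z \<in> {-1, 0, 1}"
    using Q_gt by (meson leD trit)+
  show "Q x y z < b \<Longrightarrow> y = 0" "Q x y z < c \<Longrightarrow> z = 0"
    using Q_ge by (meson leD)+
qed

text \<open>In an automorph, the norms of the columns are \<open>a \<le> b \<le> c\<close>. The entries below the diagonal and on
  it are thus always in \<open>{-1, 0, 1}\<close>; those above it are so when the corresponding diagonal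
  coefficients agree, and those below it vanish when these differ.\<close>

lemma isom_entries:
  assumes "is_isom a b c r s t ((x1, y1, z1), (x2, y2, z2), (x3, y3, z3))"
  shows "x1 \<in> {-1, 0, 1}" "y1 \<in> {-1, 0, 1}" "z1 \<in> {-1, 0, 1}"
    and "a = b \<Longrightarrow> x2 \<in> {-1, 0, 1}" "y2 \<in> {-1, 0, 1}" "z2 \<in> {-1, 0, 1}"
    and "a = c \<Longrightarrow> x3 \<in> {-1, 0, 1}" "b = c \<Longrightarrow> y3 \<in> {-1, 0, 1}" "z3 \<in> {-1, 0, 1}"
    and "a < b \<Longrightarrow> y1 = 0" "a < c \<Longrightarrow> z1 = 0" "b < c \<Longrightarrow> z2 = 0"
proof -
  have eq: "Q x1 y1 z1 = a" "Q x2 y2 z2 = b" "Q x3 y3 z3 = c" using assms by auto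
  have "a \<le> c" using basic(1,2) by linarith
  note small_coordinate[of x1 y1 z1, unfolded eq] small_coordinate[of x2 y2 z2, unfolded eq]
    small_coordinate[of x3 y3 z3, unfolded eq]
  note * = this basic(1,2) \<open>a \<le> c\<close>
  show "x1 \<in> {-1, 0, 1}" "y1 \<in> {-1, 0, 1}" "z1 \<in> {-1, 0, 1}"
    and "a = b \<Longrightarrow> x2 \<in> {-1, 0, 1}" "y2 \<in> {-1, 0, 1}" "z2 \<in> {-1, 0, 1}"
    and "a = c \<Longrightarrow> x3 \<in> {-1, 0, 1}" "b = c \<Longrightarrow> y3 \<in> {-1, 0, 1}" "z3 \<in> {-1, 0, 1}"
    using * by (metis order_refl)+
  show "a < b \<Longrightarrow> y1 = 0" "a < c \<Longrightarrow> z1 = 0" "b < c \<Longrightarrow> z2 = 0"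
    using * by metis+
qed

end

section \<open>Reduced forms with an automorph of order three\<close>

lemma small_multiple:
  fixes a k :: int
  assumes "\<bar>a * k\<bar> < 2 * a"
  shows "k \<in> {-1, 0, 1}"
proof -
  have "\<bar>a\<bar> * \<bar>k\<bar> < \<bar>a\<bar> * 2" "\<bar>a\<bar> \<ge> 0" using assms by (simp_all add: abs_mult)
  then have "\<bar>k\<bar> < 2" using mult_less_cancel_left_pos[of "\<bar>a\<bar>" "\<bar>k\<bar>" 2]
    by (metis abs_ge_zero mult_less_cancel_left_disj not_le)
  then show ?thesis by auto
qed

text \<open>The matrices of determinant \<open>1\<close> with columns \<open>(p, q)\<close> and \<open>(p', q')\<close>, entries in \<open>{-1, 0, 1}\<close> and
  third power \<open>1\<close>: the identity and four matrices of order three.\<close>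

lemma order_three_2x2:
  fixes p q p' q' :: int
  assumes "p \<in> {-1, 0, 1}" "q \<in> {-1, 0, 1}" "p' \<in> {-1, 0, 1}" "q' \<in> {-1, 0, 1}"
    and "p * q' - p' * q = 1"
    and "(p * p + q * p') * p + (p * q + q * q') * p' = 1"
    and "(p * p + q * p') * q + (p * q + q * q') * q' = 0"
    and "(p' * p + q' * p') * p + (p' * q + q' * q') * p' = 0"
    and "(p' * p + q' * p') * q + (p' * q + q' * q') * q' = 1"
  shows "(p, q, p', q') \<in> {(1, 0, 0, 1), (0, 1, -1, -1), (-1, -1, 1, 0), (0, -1, 1, -1), (-1, 1, -1, 0)}"
proof -
  have "\<forall>p\<in>{-1, 0, 1::int}. \<forall>q\<in>{-1, 0, 1::int}. \<forall>p'\<in>{-1, 0, 1::int}. \<forall>q'\<in>{-1, 0, 1::int}.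
    p * q' - p' * q = 1 \<longrightarrow>
    (p * p + q * p') * p + (p * q + q * q') * p' = 1 \<longrightarrow>
    (p * p + q * p') * q + (p * q + q * q') * q' = 0 \<longrightarrow>
    (p' * p + q' * p') * p + (p' * q + q' * q') * p' = 0 \<longrightarrow>
    (p' * p + q' * p') * q + (p' * q + q' * q') * q' = 1 \<longrightarrow>
    (p, q, p', q') \<in> {(1, 0, 0, 1), (0, 1, -1, -1), (-1, -1, 1, 0), (0, -1, 1, -1), (-1, 1, -1, 0)}"
    by simp
  from this[rule_format, OF assms] show ?thesis .
qed

context reduced_form
begin

text \<open>If \<open>a < b\<close>, then \<open>\<plusminus>e1\<close> are the only vectors of norm \<open>a\<close>, so an automorph of order three fixes \<open>e1\<close>
  and acts with order three on the quotient by it. The second possibility is a rhombohedral form: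
  there \<open>e2\<close>, \<open>e3\<close> and \<open>-(e1 + e2 + e3)\<close> are permuted.\<close>

lemma order_three_axis_e1:
  assumes isom: "is_isom a b c r s t m" and ord: "order_three m" and "a < b"
  shows "b = c \<and> (b = - 2 * r \<and> s = 0 \<and> t = 0 \<or> a = - 3 * s \<and> s = t \<and> 3 * (b + 2 * r) = a)"
proof -
  obtain x1 y1 z1 x2 y2 z2 x3 y3 z3 where m: "m = ((x1, y1, z1), (x2, y2, z2), (x3, y3, z3))"
    by (cases m) auto
  note ent = isom_entries[OF isom[unfolded m]]
  have ac: "a < c" using \<open>a < b\<close> basic(2) by linarith
  have u0: "y1 = 0" "z1 = 0" using ent(10)[OF \<open>a < b\<close>] ent(11)[OF ac] by auto
  have u1: "x1 = 1" using ord ent(1) unfolding m u0 by auto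
  \<comment> \<open>If \<open>b < c\<close>, the automorph is upper triangular, so its third power is \<open>1\<close> only for the identity.\<close>
  have bc: "b = c"
  proof (rule ccontr)
    assume "b \<noteq> c"
    then have "z2 = 0" using ent(12) basic(2) by simp
    then show False using ord ent(5,9) unfolding m u0 u1 by auto
  qed
  have y3: "y3 \<in> {-1, 0, 1}" using ent(8) bc by simp
  have det: "y2 * z3 - y3 * z2 = 1" using isom unfolding m u0 u1 by simp
  have eqs: "a * x2 + t * y2 + s * z2 = t" "a * x3 + t * y3 + s * z3 = s"
    "Q x2 y2 z2 = b" "Q x3 y3 z3 = b" "bil a b c r s t (x2, y2, z2) (x3, y3, z3) = r"
    using isom bc unfolding m u0 u1 by simp_all
  have cube: "(y2 * y2 + z2 * y3) * y2 + (y2 * z2 + z2 * z3) * y3 = 1"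
    "(y2 * y2 + z2 * y3) * z2 + (y2 * z2 + z2 * z3) * z3 = 0"
    "(y3 * y2 + z3 * y3) * y2 + (y3 * z2 + z3 * z3) * y3 = 0"
    "(y3 * y2 + z3 * y3) * z2 + (y3 * z2 + z3 * z3) * z3 = 1"
    using ord unfolding m u0 u1 by simp_all
  have "(y2, z2, y3, z3) \<noteq> (1, 0, 0, 1)"
  proof
    assume "(y2, z2, y3, z3) = (1, 0, 0, 1)"
    then show False using ord unfolding m u0 u1 by auto
  qed
  then have P: "(y2, z2, y3, z3) \<in> {(0, 1, -1, -1), (-1, -1, 1, 0), (0, -1, 1, -1), (-1, 1, -1, 0)}"
    using order_three_2x2[OF ent(5,6) y3 ent(9) det cube] by (simp only: insert_iff simp_thms)
  \<comment> \<open>Needed because \<open>isom_entries\<close> does not bound \<open>x2\<close> and \<open>x3\<close>; the inner products with \<open>e1\<close> do.\<close>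
  have abs: "\<bar>2 * s\<bar> \<le> a" "\<bar>2 * t\<bar> \<le> a" using basic by (simp_all add: abs_le_iff)
  note bnd = basic a_pos
  from P consider (A) "y2 = 0" "z2 = 1" "y3 = -1" "z3 = -1" | (B) "y2 = -1" "z2 = -1" "y3 = 1" "z3 = 0"
    | (C) "y2 = 0" "z2 = -1" "y3 = 1" "z3 = -1" | (D) "y2 = -1" "z2 = 1" "y3 = -1" "z3 = 0"
    by (simp only: insert_iff prod.inject empty_iff) blast
  then show ?thesis
  proof cases
    case A
    have x2: "x2 \<in> {-1, 0, 1}"
      by (rule small_multiple[of a]) (use A eqs(1) abs a_pos in simp)
    have x3: "x3 \<in> {-1, 0, 1}"
      by (rule small_multiple[of a]) (use A eqs(2) abs a_pos in simp)
    show ?thesis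
      using x2 x3 eqs bc bnd \<open>a < b\<close> unfolding A
      by (elim insertE emptyE; simp; smt)
  next
    case B
    have x2: "x2 \<in> {-1, 0, 1}"
      by (rule small_multiple[of a]) (use B eqs(1) abs a_pos in simp)
    have x3: "x3 \<in> {-1, 0, 1}"
      by (rule small_multiple[of a]) (use B eqs(2) abs a_pos in simp)
    show ?thesis
      using x2 x3 eqs bc bnd \<open>a < b\<close> unfolding B
      by (elim insertE emptyE; simp; smt)
  next
    case C
    have x2: "x2 \<in> {-1, 0, 1}"
      by (rule small_multiple[of a]) (use C eqs(1) abs a_pos in simp)
    have x3: "x3 \<in> {-1, 0, 1}"
      by (rule small_multiple[of a]) (use C eqs(2) abs a_pos in simp)
    \<comment> \<open>The inner products with \<open>e1\<close> leave only \<open>s = t = 0\<close>. The norm of the image of \<open>e3\<close> then gives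
      \<open>2r = b\<close>, against \<open>r \<le> 0\<close>. In the last case the image of \<open>e2\<close> gives the same.\<close>
    have False
      using x2 x3 eqs bc bnd \<open>a < b\<close> unfolding C
      by (elim insertE emptyE; simp; smt)
    then show ?thesis ..
  next
    case D
    have x2: "x2 \<in> {-1, 0, 1}"
      by (rule small_multiple[of a]) (use D eqs(1) abs a_pos in simp)
    have x3: "x3 \<in> {-1, 0, 1}"
      by (rule small_multiple[of a]) (use D eqs(2) abs a_pos in simp)
    have False
      using x2 x3 eqs bc bnd \<open>a < b\<close> unfolding D
      by (elim insertE emptyE; simp; smt)
    then show ?thesis ..
  qed
qed

text \<open>If \<open>a = b < c\<close>, the vectors of norm \<open>a\<close> lie in the plane of \<open>e1\<close> and \<open>e2\<close>, on which an automorph of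
  order three acts with order three. This plane is then a hexagonal lattice, so that \<open>a = \<plusminus>2t\<close>, and the
  invariance of the inner products of \<open>e3\<close> with the plane determines \<open>r\<close> and \<open>s\<close>.\<close>

lemma order_three_axis_e3:
  assumes isom: "is_isom a b c r s t m" and ord: "order_three m" and ab: "a = b" and "b < c"
  shows "a = - 2 * t \<and> r = 0 \<and> s = 0 \<or> a = 2 * t \<and> r = t \<and> s = t"
proof -
  obtain x1 y1 z1 x2 y2 z2 x3 y3 z3 where m: "m = ((x1, y1, z1), (x2, y2, z2), (x3, y3, z3))"
    by (cases m) auto
  note ent = isom_entries[OF isom[unfolded m]]
  have z0: "z1 = 0" "z2 = 0" using ent(11,12) ab \<open>b < c\<close> by auto
  have z1: "z3 = 1" using ord ent(9) unfolding m z0 by auto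
  have x2: "x2 \<in> {-1, 0, 1}" using ent(4) ab by simp
  have det: "x1 * y2 - x2 * y1 = 1" using isom unfolding m z0 z1 by simp
  have eqs: "Q x1 y1 0 = a" "Q x2 y2 0 = a"
    "bil a b c r s t (x1, y1, 0) (x3, y3, 1) = s" "bil a b c r s t (x2, y2, 0) (x3, y3, 1) = r"
    using isom ab unfolding m z0 z1 by simp_all
  have cube: "(x1 * x1 + y1 * x2) * x1 + (x1 * y1 + y1 * y2) * x2 = 1"
    "(x1 * x1 + y1 * x2) * y1 + (x1 * y1 + y1 * y2) * y2 = 0"
    "(x2 * x1 + y2 * x2) * x1 + (x2 * y1 + y2 * y2) * x2 = 0"
    "(x2 * x1 + y2 * x2) * y1 + (x2 * y1 + y2 * y2) * y2 = 1"
    using ord unfolding m z0 z1 by simp_all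
  have "(x1, y1, x2, y2) \<noteq> (1, 0, 0, 1)"
  proof
    assume "(x1, y1, x2, y2) = (1, 0, 0, 1)"
    then show False using ord unfolding m z0 z1 by auto
  qed
  then have P: "(x1, y1, x2, y2) \<in> {(0, 1, -1, -1), (-1, -1, 1, 0), (0, -1, 1, -1), (-1, 1, -1, 0)}"
    using order_three_2x2[OF ent(1,2) x2 ent(5) det cube] by (simp only: insert_iff simp_thms)
  note bnd = basic a_pos
  from P consider (A) "x1 = 0" "y1 = 1" "x2 = -1" "y2 = -1" | (B) "x1 = -1" "y1 = -1" "x2 = 1" "y2 = 0"
    | (C) "x1 = 0" "y1 = -1" "x2 = 1" "y2 = -1" | (D) "x1 = -1" "y1 = 1" "x2 = -1" "y2 = 0"
    by (simp only: insert_iff prod.inject empty_iff) blast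
  then show ?thesis
  proof cases
    case A
    have t: "a = - 2 * t" using A eqs ab by simp
    have sgn: "r \<le> 0" "s \<le> 0" "t \<le> 0" using t bnd by linarith+
    have aux: "s = 0" by (rule boundary(3)[OF sgn t])
    have "t * x3 - 2 * (t * y3) + r = s" "t * x3 + t * y3 - r - s = r"
      using eqs(3,4) unfolding A ab[symmetric] t by (simp_all add: algebra_simps)
    \<comment> \<open>Both unknown entries are determined up to the factor \<open>t\<close>; integrality then restricts \<open>r\<close>.\<close>
    then have xy: "t * x3 = r" "t * y3 = r" using aux by linarith+
    note lin = xy aux sgn t bnd(4-9,11)[folded ab]
    have "\<bar>a * y3\<bar> < 2 * a"
      unfolding t mult.assoc xy abs_less_iff by (intro conjI; use lin in linarith)
    then have y3: "y3 \<in> {-1, 0, 1}" by (rule small_multiple)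
    have "a \<noteq> - 2 * r" using boundary(4)[folded ab, OF sgn] t a_pos by auto
    moreover have "r = - t \<or> r = 0 \<or> r = t" using y3 xy(2) by auto
    ultimately have "r = 0" using lin by linarith
    then show ?thesis using t aux by simp
  next
    case B
    have t: "a = - 2 * t" using B eqs ab by simp
    have sgn: "r \<le> 0" "s \<le> 0" "t \<le> 0" using t bnd by linarith+
    have aux: "s = 0" by (rule boundary(3)[OF sgn t])
    have "t * x3 + t * y3 - r - s = s" "t * y3 - 2 * (t * x3) + s = r"
      using eqs(3,4) unfolding B ab[symmetric] t by (simp_all add: algebra_simps)
    then have xy: "t * x3 = 0" "t * y3 = r" using aux by linarith+
    note lin = xy aux sgn t bnd(4-9,11)[folded ab]
    have "\<bar>a * y3\<bar> < 2 * a"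
      unfolding t mult.assoc xy abs_less_iff by (intro conjI; use lin in linarith)
    then have y3: "y3 \<in> {-1, 0, 1}" by (rule small_multiple)
    have "a \<noteq> - 2 * r" using boundary(4)[folded ab, OF sgn] t a_pos by auto
    moreover have "r = - t \<or> r = 0 \<or> r = t" using y3 xy(2) by auto
    ultimately have "r = 0" using lin by linarith
    then show ?thesis using t aux by simp
  next
    case C
    have t: "a = 2 * t" using C eqs ab by simp
    have sgn: "r > 0" "s > 0" "t > 0" using t bnd by linarith+
    have aux: "r \<le> s" "s \<le> 2 * r" using boundary(1)[OF ab] boundary(5)[OF sgn t] sgn by auto
    have "- (t * x3) - 2 * (t * y3) - r = s" "t * x3 - t * y3 - r + s = r"
      using eqs(3,4) unfolding C ab[symmetric] t by (simp_all add: algebra_simps)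
    then have xy: "t * x3 = r - s" "t * y3 = - r" using aux by linarith+
    note lin = xy aux sgn t bnd(4-9,11)[folded ab]
    have "\<bar>a * y3\<bar> < 2 * a"
      unfolding t mult.assoc xy abs_less_iff by (intro conjI; use lin in linarith)
    then have y3: "y3 \<in> {-1, 0, 1}" by (rule small_multiple)
    have "- r = - t \<or> - r = 0 \<or> - r = t" using y3 xy(2) by auto
    then have "r = t" using lin by linarith
    moreover have "s \<le> t" using lin by linarith
    ultimately show ?thesis using t aux by simp
  next
    case D
    have t: "a = 2 * t" using D eqs ab by simp
    have sgn: "r > 0" "s > 0" "t > 0" using t bnd by linarith+
    have aux: "r \<le> s" "s \<le> 2 * r" using boundary(1)[OF ab] boundary(5)[OF sgn t] sgn by auto
    have "t * y3 - t * x3 + r - s = s" "- 2 * (t * x3) - t * y3 - s = r"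
      using eqs(3,4) unfolding D ab[symmetric] t by (simp_all add: algebra_simps)
    then have xy: "t * x3 = - s" "t * y3 = s - r" using aux by linarith+
    note lin = xy aux sgn t bnd(4-9,11)[folded ab]
    have "\<bar>a * x3\<bar> < 2 * a"
      unfolding t mult.assoc xy abs_less_iff by (intro conjI; use lin in linarith)
    then have x3: "x3 \<in> {-1, 0, 1}" by (rule small_multiple)
    have "\<bar>a * y3\<bar> = 2 * (s - r)" "s \<le> t"
      unfolding t mult.assoc xy using lin by (simp_all add: abs_mult)
    moreover have "s - r < a" using sgn t \<open>s \<le> t\<close> by linarith
    ultimately have "\<bar>a * y3\<bar> < 2 * a" by simp
    then have y3: "y3 \<in> {-1, 0, 1}" by (rule small_multiple)
    have "- s = - t \<or> - s = 0 \<or> - s = t" using x3 xy(1) by auto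
    then have "s = t" using lin by linarith
    moreover have "s - r = - t \<or> s - r = 0 \<or> s - r = t" using y3 xy(2) by auto
    ultimately have "r = t" using lin by linarith
    then show ?thesis using t \<open>s = t\<close> by simp
  qed
qed

end

text \<open>Three sets of vectors closed under negation: \<open>\<plusminus>e\<^sub>i\<close>; these together with \<open>\<plusminus>(e\<^sub>i - e\<^sub>j)\<close>; and \<open>\<plusminus>e\<^sub>i\<close> together
  with \<open>\<plusminus>(e1 + e2 + e3)\<close>. They are the vectors of least norm in the primitive, face-centred and
  body-centred cubic lattices, for the bases used here.\<close>

definition axis_vectors :: "ivec list" where
  "axis_vectors = [(1, 0, 0), (-1, 0, 0), (0, 1, 0), (0, -1, 0), (0, 0, 1), (0, 0, -1)]"

definition root_vectors :: "ivec list" where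
  "root_vectors =
    [(1, 0, 0), (-1, 0, 0), (0, 1, 0), (0, -1, 0), (0, 0, 1), (0, 0, -1),
     (1, -1, 0), (-1, 1, 0), (1, 0, -1), (-1, 0, 1), (0, 1, -1), (0, -1, 1)]"

definition tetrahedral_vectors :: "ivec list" where
  "tetrahedral_vectors =
    [(1, 0, 0), (-1, 0, 0), (0, 1, 0), (0, -1, 0), (0, 0, 1), (0, 0, -1),
     (1, 1, 1), (-1, -1, -1)]"

text \<open>The vectors \<open>\<plusminus>e\<^sub>i\<close>, \<open>\<plusminus>(e1 - e2)\<close> and \<open>\<plusminus>(e1 - e3)\<close>. When \<open>a = b = c\<close>, \<open>r, s, t > 0\<close> and \<open>2r < a\<close>, the
  vectors of norm \<open>a\<close> are among them.\<close>

definition difference_vectors :: "ivec list" where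
  "difference_vectors =
    [(1, 0, 0), (-1, 0, 0), (0, 1, 0), (0, -1, 0), (0, 0, 1), (0, 0, -1),
     (1, -1, 0), (-1, 1, 0), (1, 0, -1), (-1, 0, 1)]"

text \<open>The matrices of order three and determinant \<open>1\<close> with all columns in a given list. The conditional
  makes evaluation test the determinant first.\<close>

definition order_three_over :: "ivec list \<Rightarrow> (ivec \<times> ivec \<times> ivec) list" where
  "order_three_over S = filter (\<lambda>m. if det_cols m = 1 then order_three m else False) (List.product S (List.product S S))"

lemma order_three_over_difference_vectors:
  "order_three_over difference_vectors =
    [((0, 1, 0), (0, 0, 1), (1, 0, 0)),
     ((0, 1, 0), (0, 0, -1), (-1, 0, 0)),
     ((0, 1, 0), (1, 0, -1), (-1, 1, 0)),
     ((0, -1, 0), (0, 0, 1), (-1, 0, 0)),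
     ((0, -1, 0), (0, 0, -1), (1, 0, 0)),
     ((0, -1, 0), (1, -1, 0), (0, 0, 1)),
     ((0, -1, 0), (1, -1, 0), (-1, 0, 1)),
     ((0, -1, 0), (1, 0, -1), (1, -1, 0)),
     ((0, 0, 1), (1, 0, 0), (0, 1, 0)),
     ((0, 0, 1), (-1, 0, 0), (0, -1, 0)),
     ((0, 0, 1), (-1, 0, 1), (1, -1, 0)),
     ((0, 0, -1), (1, 0, 0), (0, -1, 0)),
     ((0, 0, -1), (-1, 0, 0), (0, 1, 0)),
     ((0, 0, -1), (0, 1, 0), (1, 0, -1)),
     ((0, 0, -1), (-1, 1, 0), (1, 0, -1)),
     ((0, 0, -1), (1, 0, -1), (1, -1, 0)),
     ((-1, 1, 0), (-1, 0, 0), (0, 0, 1)),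
     ((-1, 1, 0), (-1, 0, 0), (-1, 0, 1)),
     ((-1, 1, 0), (-1, 0, 1), (0, 0, 1)),
     ((-1, 0, 1), (0, 1, 0), (-1, 0, 0)),
     ((-1, 0, 1), (0, 1, 0), (-1, 1, 0)),
     ((-1, 0, 1), (-1, 1, 0), (-1, 0, 0))]"
  by code_simp

lemma order_three_over_tetrahedral_vectors:
  "order_three_over tetrahedral_vectors =
    [((1, 0, 0), (0, 0, 1), (-1, -1, -1)),
     ((1, 0, 0), (-1, -1, -1), (0, 1, 0)),
     ((0, 1, 0), (0, 0, 1), (1, 0, 0)),
     ((0, 1, 0), (0, 0, -1), (-1, 0, 0)),
     ((0, 1, 0), (-1, -1, -1), (0, 0, 1)),
     ((0, -1, 0), (0, 0, 1), (-1, 0, 0)),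
     ((0, -1, 0), (0, 0, -1), (1, 0, 0)),
     ((0, 0, 1), (1, 0, 0), (0, 1, 0)),
     ((0, 0, 1), (-1, 0, 0), (0, -1, 0)),
     ((0, 0, 1), (0, 1, 0), (-1, -1, -1)),
     ((0, 0, -1), (1, 0, 0), (0, -1, 0)),
     ((0, 0, -1), (-1, 0, 0), (0, 1, 0)),
     ((-1, -1, -1), (1, 0, 0), (0, 0, 1)),
     ((-1, -1, -1), (0, 1, 0), (1, 0, 0))]"
  by code_simp

lemma mem_order_three_over:
  assumes "u \<in> set S" "v \<in> set S" "w \<in> set S" and "is_isom a b c r s t (u, v, w)" "order_three (u, v, w)"
  shows "(u, v, w) \<in> set (order_three_over S)"
  using assms by (simp add: order_three_over_def del: order_three.simps det_cols.simps)

context reduced_form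
begin

text \<open>For equal diagonal coefficients, the columns of an automorph are vectors of norm \<open>a\<close>. In the
  remaining cases \<open>2r = a\<close> and \<open>a = -2t\<close> the conditions of reduction already determine the form.\<close>

lemma minimal_vectors_pos:
  assumes "a = b" "b = c" "r > 0" "s > 0" "t > 0" "2 * r < a" and "Q x y z = a"
  shows "(x, y, z) \<in> set difference_vectors"
proof -
  have "x \<in> {-1, 0, 1}" "y \<in> {-1, 0, 1}" "z \<in> {-1, 0, 1}"
    using small_coordinate[of x y z] assms by simp_all
  then have "(x, y, z) \<in> set difference_vectors \<or> Q x y z \<noteq> a"
    unfolding difference_vectors_def
    by (elim insertE emptyE; hypsubst; (simp (no_asm))?; use assms(1-6) basic(1-9) a_pos in linarith)
  then show ?thesis using assms by simp
qed

lemma minimal_vectors_nonpos: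
  assumes "a = b" "b = c" "r \<le> 0" "s \<le> 0" "t \<le> 0" "- a < 2 * r" "- a < 2 * s" "- a < 2 * t" and "Q x y z = a"
  shows "(x, y, z) \<in> set tetrahedral_vectors"
proof -
  have "x \<in> {-1, 0, 1}" "y \<in> {-1, 0, 1}" "z \<in> {-1, 0, 1}"
    using small_coordinate[of x y z] assms by simp_all
  then have "(x, y, z) \<in> set tetrahedral_vectors \<or> Q x y z \<noteq> a"
    unfolding tetrahedral_vectors_def
    by (elim insertE emptyE; hypsubst; (simp (no_asm))?; use assms(1-8) basic(1-9) a_pos in linarith)
  then show ?thesis using assms by simp
qed

lemma order_three_equal_diagonal:
  assumes isom: "is_isom a b c r s t m" and ord: "order_three m" and ab: "a = b" and bc: "b = c"
  shows "r = s \<and> s = t \<or> a = - 2 * t \<and> r = 0 \<and> s = 0"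
proof -
  obtain u v w where m: "m = (u, v, w)" by (cases m) auto
  have norm: "bil a b c r s t u u = a" "bil a b c r s t v v = a" "bil a b c r s t w w = a"
    using isom ab bc unfolding m by auto
  have le: "\<bar>r\<bar> \<le> \<bar>s\<bar>" "\<bar>s\<bar> \<le> \<bar>t\<bar>" using boundary(1,2) ab bc by auto
  show ?thesis
  proof (cases rule: sign_cases)
    case sgn: pos
    have le': "r \<le> s" "s \<le> t" using le sgn by simp_all
    show ?thesis
    proof (cases "2 * r < a")
      case True
      have min: "x \<in> set difference_vectors" if "bil a b c r s t x x = a" for x
        using minimal_vectors_pos[OF ab bc sgn True] that by (cases x) auto
      have "m \<in> set (order_three_over difference_vectors)"
        using mem_order_three_over[OF min min min] norm isom ord unfolding m by blast
      then have "r = s \<and> s = t"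
        using isom unfolding order_three_over_difference_vectors list.set ab[symmetric] bc[symmetric]
        by (elim insertE emptyE; hypsubst; simp (no_asm_use); (elim conjE)?;
            use sgn le' basic(4,6) True in linarith)
      then show ?thesis ..
    next
      case False
      \<comment> \<open>\<open>a \<le> 2r \<le> 2s \<le> 2t \<le> a\<close>\<close>
      then show ?thesis using le sgn basic by linarith
    qed
  next
    case sgn: nonpos
    have le': "s \<le> r" "t \<le> s" using le sgn by simp_all
    show ?thesis
    proof (cases "a = - 2 * t")
      case True
      then have "s = 0" using boundary(3)[OF sgn] by simp
      then show ?thesis using True le by simp
    next
      case False
      then have lt: "- a < 2 * r" "- a < 2 * s" "- a < 2 * t" using le sgn basic by linarith+
      have min: "x \<in> set tetrahedral_vectors" if "bil a b c r s t x x = a" for x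
        using minimal_vectors_nonpos[OF ab bc sgn lt] that by (cases x) auto
      have "m \<in> set (order_three_over tetrahedral_vectors)"
        using mem_order_three_over[OF min min min] norm isom ord unfolding m by blast
      then have "r = s \<and> s = t"
        using isom unfolding order_three_over_tetrahedral_vectors list.set ab[symmetric] bc[symmetric]
        by (elim insertE emptyE; hypsubst; simp (no_asm_use); (elim conjE)?;
            use sgn le' lt in linarith)
      then show ?thesis ..
    qed
  qed
qed

end

section \<open>Counting automorphs: cubic lattices\<close>

text \<open>The automorphs, with all columns in the list \<open>S\<close>, of the form with diagonal coefficients \<open>a\<close> and
  off-diagonal coefficients \<open>r\<close>. The norms are not tested; \<open>S\<close> is meant to consist of vectors of norm
  \<open>a\<close>. Filtering column by column keeps the evaluation short.\<close>

definition isoms_over :: "int \<Rightarrow> int \<Rightarrow> ivec list \<Rightarrow> (ivec \<times> ivec \<times> ivec) list" where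
  "isoms_over a r S =
     concat (map (\<lambda>u. concat (map (\<lambda>v. map (\<lambda>w. (u, v, w))
         (filter (\<lambda>w. bil a a a r r r u w = r \<and> bil a a a r r r v w = r \<and> det_cols (u, v, w) = 1) S))
       (filter (\<lambda>v. bil a a a r r r u v = r) S))) S)"

lemma set_isoms_over:
  assumes S: "\<And>x. bil a a a r r r x x = a \<longleftrightarrow> x \<in> set S"
  shows "{m. is_isom a a a r r r m} = set (isoms_over a r S)"
proof (rule Set.set_eqI)
  fix m :: "ivec \<times> ivec \<times> ivec"
  obtain u v w where m: "m = (u, v, w)" by (cases m) auto
  have "(u, v, w) \<in> set (isoms_over a r S) \<longleftrightarrow> u \<in> set S \<and> v \<in> set S \<and> w \<in> set S \<and>
      bil a a a r r r u v = r \<and> bil a a a r r r u w = r \<and> bil a a a r r r v w = r \<and> det_cols (u, v, w) = 1"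
    by (auto simp: isoms_over_def image_iff simp del: det_cols.simps bil.simps split_paired_Ex split_paired_All)
  then show "m \<in> {m. is_isom a a a r r r m} \<longleftrightarrow> m \<in> set (isoms_over a r S)"
    unfolding m using S by (simp del: det_cols.simps)
qed

lemma is_isom_scale:
  assumes "k \<noteq> 0"
  shows "is_isom (k * a) (k * b) (k * c) (k * r) (k * s) (k * t) m \<longleftrightarrow> is_isom a b c r s t m"
proof -
  have "bil (k * a) (k * b) (k * c) (k * r) (k * s) (k * t) x y = k * bil a b c r s t x y" for x y
    by (cases x; cases y) (simp add: algebra_simps)
  moreover obtain u v w where "m = (u, v, w)" by (cases m) auto
  ultimately show ?thesis using assms by (simp del: det_cols.simps bil.simps)
qed

lemma card_isoms_over:
  "card (set (isoms_over 1 0 axis_vectors)) = 24"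
  "card (set (isoms_over 2 1 root_vectors)) = 24"
  "card (set (isoms_over 3 (-1) tetrahedral_vectors)) = 24"
  "card (set (isoms_over 3 1 axis_vectors)) = 6"
  by code_simp+

text \<open>These concrete forms are reduced, so the general bounds apply to them.\<close>

lemma numeric_minimal_vectors:
  shows "bil 1 1 1 0 0 0 x x = 1 \<longleftrightarrow> x \<in> set axis_vectors"
    and "bil 2 2 2 1 1 1 x x = 2 \<longleftrightarrow> x \<in> set root_vectors"
    and "bil 3 3 3 (-1) (-1) (-1) x x = 3 \<longleftrightarrow> x \<in> set tetrahedral_vectors"
    and "bil 3 3 3 1 1 1 x x = 3 \<longleftrightarrow> x \<in> set axis_vectors"
proof -
  obtain p q z where x: "x = (p, q, z)" by (cases x)
  interpret c: reduced_form 1 1 1 0 0 0 by unfold_locales (auto simp: eisenstein_reduced_def)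
  interpret f: reduced_form 2 2 2 1 1 1 by unfold_locales (auto simp: eisenstein_reduced_def)
  interpret b: reduced_form 3 3 3 "-1" "-1" "-1" by unfold_locales (auto simp: eisenstein_reduced_def)
  interpret g: reduced_form 3 3 3 1 1 1 by unfold_locales (auto simp: eisenstein_reduced_def)
  have trits: "p \<in> {-1, 0, 1} \<and> q \<in> {-1, 0, 1} \<and> z \<in> {-1, 0, 1}"
    if "bil 1 1 1 0 0 0 x x = 1 \<or> bil 2 2 2 1 1 1 x x = 2 \<or> bil 3 3 3 (-1) (-1) (-1) x x = 3 \<or> bil 3 3 3 1 1 1 x x = 3"
    using that c.small_coordinate(1-3)[of p q z] f.small_coordinate(1-3)[of p q z]
      b.small_coordinate(1-3)[of p q z] g.small_coordinate(1-3)[of p q z]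
    unfolding x by (elim disjE) (simp_all only: order_refl simp_thms)
  have num: "\<forall>p\<in>{-1, 0, 1}. \<forall>q\<in>{-1, 0, 1}. \<forall>z\<in>{-1, 0, 1}.
     (bil 1 1 1 0 0 0 (p, q, z) (p, q, z) = 1 \<longrightarrow> (p, q, z) \<in> set axis_vectors) \<and>
     (bil 2 2 2 1 1 1 (p, q, z) (p, q, z) = 2 \<longrightarrow> (p, q, z) \<in> set root_vectors) \<and>
     (bil 3 3 3 (-1) (-1) (-1) (p, q, z) (p, q, z) = 3 \<longrightarrow> (p, q, z) \<in> set tetrahedral_vectors) \<and>
     (bil 3 3 3 1 1 1 (p, q, z) (p, q, z) = 3 \<longrightarrow> (p, q, z) \<in> set axis_vectors)"
    by (simp add: axis_vectors_def root_vectors_def tetrahedral_vectors_def)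
  have rev: "x \<in> set axis_vectors \<Longrightarrow> bil 1 1 1 0 0 0 x x = 1 \<and> bil 3 3 3 1 1 1 x x = 3"
    "x \<in> set root_vectors \<Longrightarrow> bil 2 2 2 1 1 1 x x = 2"
    "x \<in> set tetrahedral_vectors \<Longrightarrow> bil 3 3 3 (-1) (-1) (-1) x x = 3"
    by (auto simp: axis_vectors_def root_vectors_def tetrahedral_vectors_def)
  show "bil 1 1 1 0 0 0 x x = 1 \<longleftrightarrow> x \<in> set axis_vectors"
    "bil 2 2 2 1 1 1 x x = 2 \<longleftrightarrow> x \<in> set root_vectors"
    "bil 3 3 3 (-1) (-1) (-1) x x = 3 \<longleftrightarrow> x \<in> set tetrahedral_vectors"
    "bil 3 3 3 1 1 1 x x = 3 \<longleftrightarrow> x \<in> set axis_vectors"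
    using num[rule_format, of p q z] trits rev unfolding x by blast+
qed

lemma card_isom_cubic:
  assumes "k \<noteq> 0"
  shows "card {m. is_isom k k k 0 0 0 m} = 24"
    and "card {m. is_isom (2 * k) (2 * k) (2 * k) k k k m} = 24"
    and "card {m. is_isom (3 * k) (3 * k) (3 * k) (- k) (- k) (- k) m} = 24"
  using is_isom_scale[OF assms, of 1 1 1 0 0 0] is_isom_scale[OF assms, of 2 2 2 1 1 1]
    is_isom_scale[OF assms, of 3 3 3 "-1" "-1" "-1"]
    card_isoms_over set_isoms_over[OF numeric_minimal_vectors(1)]
    set_isoms_over[OF numeric_minimal_vectors(2)] set_isoms_over[OF numeric_minimal_vectors(3)]
  by (simp_all add: mult.commute del: is_isom.simps)

section \<open>Counting automorphs: rhombohedral lattices\<close>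

text \<open>The automorphs of the planar hexagonal lattice, in a basis with angle 120 degrees and then in one
  with angle 60 degrees.\<close>

lemma hexagonal_isometries:
  fixes p q p' q' :: int
  assumes "p \<in> {-1, 0, 1}" "q \<in> {-1, 0, 1}" "p' \<in> {-1, 0, 1}" "q' \<in> {-1, 0, 1}"
    and "p * p - p * q + q * q = 1" "p' * p' - p' * q' + q' * q' = 1"
    and "2 * p * p' + 2 * q * q' - p * q' - q * p' = -1"
  shows "(p, q, p', q') \<in>
    {(-1, -1, 0, 1), (-1, -1, 1, 0), (-1, 0, 0, -1),
     (-1, 0, 1, 1), (0, -1, -1, 0), (0, -1, 1, 1),
     (0, 1, -1, -1), (0, 1, 1, 0), (1, 0, -1, -1),
     (1, 0, 0, 1), (1, 1, -1, 0), (1, 1, 0, -1)}"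
proof -
  have "\<forall>p\<in>{-1, 0, 1::int}. \<forall>q\<in>{-1, 0, 1::int}. \<forall>p'\<in>{-1, 0, 1::int}. \<forall>q'\<in>{-1, 0, 1::int}.
    p * p - p * q + q * q = 1 \<longrightarrow> p' * p' - p' * q' + q' * q' = 1 \<longrightarrow>
    2 * p * p' + 2 * q * q' - p * q' - q * p' = -1 \<longrightarrow>
    (p, q, p', q') \<in>
    {(-1, -1, 0, 1), (-1, -1, 1, 0), (-1, 0, 0, -1),
     (-1, 0, 1, 1), (0, -1, -1, 0), (0, -1, 1, 1),
     (0, 1, -1, -1), (0, 1, 1, 0), (1, 0, -1, -1),
     (1, 0, 0, 1), (1, 1, -1, 0), (1, 1, 0, -1)}"
    by simp
  from this[rule_format, OF assms] show ?thesis .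
qed

lemma hexagonal_isometries_acute:
  fixes p q p' q' :: int
  assumes "p \<in> {-1, 0, 1}" "q \<in> {-1, 0, 1}" "p' \<in> {-1, 0, 1}" "q' \<in> {-1, 0, 1}"
    and "p * p + p * q + q * q = 1" "p' * p' + p' * q' + q' * q' = 1"
    and "2 * p * p' + 2 * q * q' + p * q' + q * p' = 1"
  shows "(p, q, p', q') \<in>
    {(-1, 0, -1, 1), (-1, 0, 0, -1), (-1, 1, -1, 0),
     (-1, 1, 0, 1), (0, -1, -1, 0), (0, -1, 1, -1),
     (0, 1, -1, 1), (0, 1, 1, 0), (1, -1, 0, -1),
     (1, -1, 1, 0), (1, 0, 0, 1), (1, 0, 1, -1)}"
proof -
  have "\<forall>p\<in>{-1, 0, 1::int}. \<forall>q\<in>{-1, 0, 1::int}. \<forall>p'\<in>{-1, 0, 1::int}. \<forall>q'\<in>{-1, 0, 1::int}.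
    p * p + p * q + q * q = 1 \<longrightarrow> p' * p' + p' * q' + q' * q' = 1 \<longrightarrow>
    2 * p * p' + 2 * q * q' + p * q' + q * p' = 1 \<longrightarrow>
    (p, q, p', q') \<in>
    {(-1, 0, -1, 1), (-1, 0, 0, -1), (-1, 1, -1, 0),
     (-1, 1, 0, 1), (0, -1, -1, 0), (0, -1, 1, -1),
     (0, 1, -1, 1), (0, 1, 1, 0), (1, -1, 0, -1),
     (1, -1, 1, 0), (1, 0, 0, 1), (1, 0, 1, -1)}"
    by simp
  from this[rule_format, OF assms] show ?thesis .
qed

text \<open>The possible images of \<open>e2\<close> and \<open>e3\<close> for the form of \<open>order_three_axis_e1\<close> with \<open>a = -3s = -3t\<close>, when
  \<open>e1\<close> is mapped to itself or to its negative: the inner product with \<open>e1\<close> determines \<open>x\<close> and forces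
  a congruence modulo \<open>3\<close>.\<close>

lemma rhombohedral_columns:
  fixes x y z :: int
  assumes "y \<in> {-1, 0, 1}" "z \<in> {-1, 0, 1}"
  shows "3 * x = y + z - 1 \<Longrightarrow> (x, y, z) \<in> {(0, 1, 0), (0, 0, 1), (-1, -1, -1)}"
    and "3 * x = y + z + 1 \<Longrightarrow> (x, y, z) \<in> {(0, -1, 0), (0, 0, -1), (1, 1, 1)}"
  using assms by (elim insertE emptyE; simp; presburger)+

context reduced_form
begin

lemma isom_rhombohedral_e1_subset:
  assumes "a < b" "b = c" "a = - 3 * t" "s = t"
  shows "{m. is_isom a b c r s t m} \<subseteq>
    {((-1, 0, 0), (0, -1, 0), (1, 1, 1)), ((-1, 0, 0), (0, 0, -1), (0, -1, 0)), ((-1, 0, 0), (1, 1, 1), (0, 0, -1)),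
     ((1, 0, 0), (-1, -1, -1), (0, 1, 0)), ((1, 0, 0), (0, 0, 1), (-1, -1, -1)), ((1, 0, 0), (0, 1, 0), (0, 0, 1))}"
    (is "_ \<subseteq> ?M")
proof
  fix m assume "m \<in> {m. is_isom a b c r s t m}"
  then have isom: "is_isom a b c r s t m" by simp
  obtain x1 y1 z1 x2 y2 z2 x3 y3 z3 where m: "m = ((x1, y1, z1), (x2, y2, z2), (x3, y3, z3))"
    by (cases m) auto
  note ent = isom_entries[OF isom[unfolded m]]
  have u0: "y1 = 0" "z1 = 0" using ent(10,11) assms by auto
  have "x1 \<noteq> 0" using isom unfolding m u0 by auto
  have t: "t \<noteq> 0" using assms a_pos by auto
  have det: "x1 * (y2 * z3 - y3 * z2) = 1" using isom unfolding m u0 by simp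
  have eqs: "x1 * (3 * x2 - y2 - z2) = -1" "x1 * (3 * x3 - y3 - z3) = -1"
  proof -
    have "t * (x1 * (3 * x2 - y2 - z2)) = t * -1" "t * (x1 * (3 * x3 - y3 - z3)) = t * -1"
      using isom unfolding m u0 assms(3,4) by (simp_all add: algebra_simps)
    then show "x1 * (3 * x2 - y2 - z2) = -1" "x1 * (3 * x3 - y3 - z3) = -1"
      using mult_left_cancel[OF t] by blast+
  qed
  have y3: "y3 \<in> {-1, 0, 1}" using ent(8) assms by simp
  consider "x1 = 1" | "x1 = -1" using ent(1) \<open>x1 \<noteq> 0\<close> by auto
  then show "m \<in> ?M"
  proof cases
    case 1
    have "(x2, y2, z2) \<in> {(0, 1, 0), (0, 0, 1), (-1, -1, -1)}" "(x3, y3, z3) \<in> {(0, 1, 0), (0, 0, 1), (-1, -1, -1)}"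
      using rhombohedral_columns(1) ent(5,6,9) y3 eqs 1 by simp_all
    then show ?thesis using det unfolding m u0 1 by (elim insertE emptyE; simp)
  next
    case 2
    have "(x2, y2, z2) \<in> {(0, -1, 0), (0, 0, -1), (1, 1, 1)}" "(x3, y3, z3) \<in> {(0, -1, 0), (0, 0, -1), (1, 1, 1)}"
      using rhombohedral_columns(2) ent(5,6,9) y3 eqs 2 by simp_all
    then show ?thesis using det unfolding m u0 2 by (elim insertE emptyE; simp)
  qed
qed

text \<open>The first two columns form one of the twelve automorphs of the hexagonal plane. The third column is
  determined by its inner products with them and by the determinant, and is integral for only six.\<close>

lemma isom_rhombohedral_e3_subset:
  assumes "a = b" "b < c" "a = 2 * t" "r = t" "s = t"
  shows "{m. is_isom a b c r s t m} \<subseteq>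
    {((-1, 1, 0), (-1, 0, 0), (-1, 0, 1)), ((-1, 1, 0), (0, 1, 0), (0, 1, -1)), ((0, -1, 0), (-1, 0, 0), (0, 0, -1)),
     ((0, -1, 0), (1, -1, 0), (0, -1, 1)), ((1, 0, 0), (0, 1, 0), (0, 0, 1)), ((1, 0, 0), (1, -1, 0), (1, 0, -1))}"
    (is "_ \<subseteq> ?M")
proof
  fix m assume "m \<in> {m. is_isom a b c r s t m}"
  then have isom: "is_isom a b c r s t m" by simp
  obtain x1 y1 z1 x2 y2 z2 x3 y3 z3 where m: "m = ((x1, y1, z1), (x2, y2, z2), (x3, y3, z3))"
    by (cases m) auto
  note ent = isom_entries[OF isom[unfolded m]]
  have z0: "z1 = 0" "z2 = 0" using ent(11,12) assms by auto
  have x2: "x2 \<in> {-1, 0, 1}" using ent(4) assms by simp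
  have t: "t \<noteq> 0" using assms a_pos by auto
  have det: "z3 * (x1 * y2 - x2 * y1) = 1" using isom unfolding m z0 by (simp add: algebra_simps)
  have b: "b = 2 * t" using assms by simp
  have eqs: "x1 * x1 + x1 * y1 + y1 * y1 = 1" "x2 * x2 + x2 * y2 + y2 * y2 = 1"
    "2 * x1 * x2 + 2 * y1 * y2 + x1 * y2 + y1 * x2 = 1"
    "2 * x1 * x3 + 2 * y1 * y3 + x1 * y3 + y1 * x3 + z3 * (x1 + y1) = 1"
    "2 * x2 * x3 + 2 * y2 * y3 + x2 * y3 + y2 * x3 + z3 * (x2 + y2) = 1"
  proof -
    have "2 * t * (x1 * x1 + x1 * y1 + y1 * y1) = 2 * t * 1" "2 * t * (x2 * x2 + x2 * y2 + y2 * y2) = 2 * t * 1"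
      "t * (2 * x1 * x2 + 2 * y1 * y2 + x1 * y2 + y1 * x2) = t * 1"
      "t * (2 * x1 * x3 + 2 * y1 * y3 + x1 * y3 + y1 * x3 + z3 * (x1 + y1)) = t * 1"
      "t * (2 * x2 * x3 + 2 * y2 * y3 + x2 * y3 + y2 * x3 + z3 * (x2 + y2)) = t * 1"
      using isom unfolding m z0 assms(3-5) b by (simp_all add: algebra_simps)
    then show "x1 * x1 + x1 * y1 + y1 * y1 = 1" "x2 * x2 + x2 * y2 + y2 * y2 = 1"
      "2 * x1 * x2 + 2 * y1 * y2 + x1 * y2 + y1 * x2 = 1"
      "2 * x1 * x3 + 2 * y1 * y3 + x1 * y3 + y1 * x3 + z3 * (x1 + y1) = 1"
      "2 * x2 * x3 + 2 * y2 * y3 + x2 * y3 + y2 * x3 + z3 * (x2 + y2) = 1"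
      using mult_left_cancel[OF t] mult_left_cancel[of "2 * t"] t by simp_all
  qed
  have P: "(x1, y1, x2, y2) \<in>
     {(-1, 0, -1, 1), (-1, 0, 0, -1), (-1, 1, -1, 0),
     (-1, 1, 0, 1), (0, -1, -1, 0), (0, -1, 1, -1),
     (0, 1, -1, 1), (0, 1, 1, 0), (1, -1, 0, -1),
     (1, -1, 1, 0), (1, 0, 0, 1), (1, 0, 1, -1)}"
    by (rule hexagonal_isometries_acute[OF ent(1,2) x2 ent(5) eqs(1-3)])
  show "m \<in> ?M"
    using P ent(9) det eqs(4,5) unfolding m z0
    by (elim insertE emptyE; simp; presburger)
qed

lemma minimal_vectors_axis:
  assumes "a = b" "b = c" "r = s" "s = t" "2 * r < a" "- a < 3 * r" and "Q x y z = a"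
  shows "(x, y, z) \<in> set axis_vectors"
proof -
  have "x \<in> {-1, 0, 1}" "y \<in> {-1, 0, 1}" "z \<in> {-1, 0, 1}"
    using small_coordinate[of x y z] assms by simp_all
  then have "(x, y, z) \<in> set axis_vectors \<or> Q x y z \<noteq> a"
    unfolding axis_vectors_def
    by (elim insertE emptyE; hypsubst; (simp (no_asm))?; use assms(1-6) a_pos in linarith)
  then show ?thesis using assms by simp
qed

text \<open>Here an automorph permutes the vectors \<open>\<plusminus>e\<^sub>i\<close>. Since \<open>r\<close> is neither \<open>0\<close> nor \<open>\<plusminus>a\<close>, which signed
  permutations occur does not depend on \<open>a\<close> and \<open>r\<close>, and may be computed for \<open>a = 3\<close>, \<open>r = 1\<close>.\<close>

lemma card_isom_rhombohedral:
  assumes "a = b" "b = c" "r = s" "s = t" "2 * r < a" "- a < 3 * r" "r \<noteq> 0"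
  shows "card {m. is_isom a b c r s t m} \<le> 6"
proof -
  have eq: "b = a" "c = a" "s = r" "t = r" using assms by auto
  have min: "x \<in> set axis_vectors" if "bil a a a r r r x x = a" for x
    using minimal_vectors_axis[OF assms(1-6)] that unfolding eq by (cases x) auto
  have num: "bil 3 3 3 1 1 1 u v = 1" if "u \<in> set axis_vectors" "v \<in> set axis_vectors" "bil a a a r r r u v = r" for u v
    using that unfolding axis_vectors_def list.set
    by (elim insertE emptyE; hypsubst; simp (no_asm_use); use assms(5-7) a_pos in linarith)
  have "{m. is_isom a b c r s t m} \<subseteq> {m. is_isom 3 3 3 1 1 1 m}"
  proof clarify
    fix u v w assume m: "is_isom a b c r s t (u, v, w)"
    then have "u \<in> set axis_vectors" "v \<in> set axis_vectors" "w \<in> set axis_vectors"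
      using min unfolding eq by auto
    then show "is_isom 3 3 3 1 1 1 (u, v, w)"
      using m num numeric_minimal_vectors(4) unfolding eq is_isom.simps by blast
  qed
  then have "card {m. is_isom a b c r s t m} \<le> card {m. is_isom 3 3 3 1 1 1 m}"
    unfolding set_isoms_over[OF numeric_minimal_vectors(4)] by (intro card_mono) auto
  then show ?thesis
    unfolding set_isoms_over[OF numeric_minimal_vectors(4)] card_isoms_over .
qed

end

section \<open>Counting automorphs: hexagonal lattices\<close>

text \<open>The automorphs of determinant \<open>1\<close> of a hexagonal lattice whose axis is spanned by \<open>e3\<close>, respectively
  by \<open>e1\<close>: an automorph of the hexagonal plane, with the sign on the axis given by its determinant.\<close>

definition hexagonal_isoms_e3 :: "(ivec \<times> ivec \<times> ivec) list" where
  "hexagonal_isoms_e3 =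
    [((-1, -1, 0), (0, 1, 0), (0, 0, -1)), ((-1, -1, 0), (1, 0, 0), (0, 0, 1)), ((-1, 0, 0), (0, -1, 0), (0, 0, 1)),
     ((-1, 0, 0), (1, 1, 0), (0, 0, -1)), ((0, -1, 0), (-1, 0, 0), (0, 0, -1)), ((0, -1, 0), (1, 1, 0), (0, 0, 1)),
     ((0, 1, 0), (-1, -1, 0), (0, 0, 1)), ((0, 1, 0), (1, 0, 0), (0, 0, -1)), ((1, 0, 0), (-1, -1, 0), (0, 0, -1)),
     ((1, 0, 0), (0, 1, 0), (0, 0, 1)), ((1, 1, 0), (-1, 0, 0), (0, 0, 1)), ((1, 1, 0), (0, -1, 0), (0, 0, -1))]"

definition hexagonal_isoms_e1 :: "(ivec \<times> ivec \<times> ivec) list" where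
  "hexagonal_isoms_e1 =
    [((-1, 0, 0), (0, -1, -1), (0, 0, 1)), ((-1, 0, 0), (0, -1, 0), (0, 1, 1)), ((-1, 0, 0), (0, 0, -1), (0, -1, 0)),
     ((-1, 0, 0), (0, 0, 1), (0, 1, 0)), ((-1, 0, 0), (0, 1, 0), (0, -1, -1)), ((-1, 0, 0), (0, 1, 1), (0, 0, -1)),
     ((1, 0, 0), (0, -1, -1), (0, 1, 0)), ((1, 0, 0), (0, -1, 0), (0, 0, -1)), ((1, 0, 0), (0, 0, -1), (0, 1, 1)),
     ((1, 0, 0), (0, 0, 1), (0, -1, -1)), ((1, 0, 0), (0, 1, 0), (0, 0, 1)), ((1, 0, 0), (0, 1, 1), (0, -1, 0))]"

context reduced_form
begin

lemma card_isom_hexagonal_e3: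
  assumes "a = b" "a = - 2 * t" "r = 0" "s = 0"
  shows "card {m. is_isom a b c r s t m} = 12"
proof -
  define h where "h = - t"
  have h: "h > 0" and a: "a = 2 * h" and b: "b = 2 * h" and t: "t = - h"
    using a_pos assms unfolding h_def by auto
  have c: "2 * h \<le> c" using basic(2) b by simp
  have "m \<in> set hexagonal_isoms_e3" if isom: "is_isom a b c r s t m" for m
  proof -
    obtain x1 y1 z1 x2 y2 z2 x3 y3 z3 where m: "m = ((x1, y1, z1), (x2, y2, z2), (x3, y3, z3))"
      by (cases m) auto
    note ent = isom_entries[OF isom[unfolded m]]
    have x2: "x2 \<in> {-1, 0, 1}" using ent(4) assms by simp
    have uv: "h * (2 * x1 * x2 + 2 * y1 * y2 - x1 * y2 - y1 * x2) + c * z1 * z2 = - h"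
      using isom unfolding m a b t assms(3,4) by (simp add: algebra_simps)
    have norm: "2 * h * (x1 * x1 - x1 * y1 + y1 * y1) + c * z1 * z1 = 2 * h"
      "2 * h * (x2 * x2 - x2 * y2 + y2 * y2) + c * z2 * z2 = 2 * h"
      using isom unfolding m a b t assms(3,4) by (simp_all add: algebra_simps)
    \<comment> \<open>If \<open>c = a\<close>, the vectors \<open>\<plusminus>e3\<close> also have norm \<open>a\<close>; the inner product \<open>-a/2\<close> of the first two
      columns shows that neither of them is such a vector.\<close>
    have vertical: "x = 0 \<and> y = 0 \<and> c = 2 * h"
      if "x \<in> {-1, 0, 1}" "y \<in> {-1, 0, 1}" "z \<in> {-1, 0, 1}" "z \<noteq> 0"
        "2 * h * (x * x - x * y + y * y) + c * z * z = 2 * h" for x y z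
      using that c h by (elim insertE emptyE; simp)
    have odd: "2 * h * k \<noteq> - h" for k
    proof
      assume "2 * h * k = - h"
      then have "h * (2 * k) = h * -1" by simp
      then have "2 * k = -1" using h mult_left_cancel[of h "2 * k" "-1"] by simp
      then show False by presburger
    qed
    have z1: "z1 = 0"
    proof (rule ccontr)
      assume "z1 \<noteq> 0"
      from vertical[OF ent(1,2,3) this norm(1)] uv odd[of "z1 * z2"] show False
        by (simp add: algebra_simps)
    qed
    have z2: "z2 = 0"
    proof (rule ccontr)
      assume "z2 \<noteq> 0"
      from vertical[OF x2 ent(5,6) this norm(2)] uv odd[of "z1 * z2"] show False
        by (simp add: algebra_simps)
    qed
    have hc: "h * k = h * l \<longleftrightarrow> k = l" for k l using h by simp
    have "h * (x1 * x1 - x1 * y1 + y1 * y1) = h * 1" "h * (x2 * x2 - x2 * y2 + y2 * y2) = h * 1"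
      "h * (2 * x1 * x2 + 2 * y1 * y2 - x1 * y2 - y1 * x2) = h * -1"
      using uv norm unfolding z1 z2 by simp_all
    note P = hexagonal_isometries[OF ent(1,2) x2 ent(5) this[unfolded hc]]
    have "h * (2 * x1 * x3 + 2 * y1 * y3 - x1 * y3 - y1 * x3) = h * 0"
      "h * (2 * x2 * x3 + 2 * y2 * y3 - x2 * y3 - y2 * x3) = h * 0"
      using isom unfolding m a b t assms(3,4) z1 z2 by (simp_all add: algebra_simps)
    note w = this[unfolded hc]
    have det: "z3 * (x1 * y2 - x2 * y1) = 1"
      using isom unfolding m z1 z2 by (simp add: algebra_simps)
    show ?thesis
      using P ent(9) det w unfolding m z1 z2 hexagonal_isoms_e3_def
      by (elim insertE emptyE; simp; presburger)
  qed
  moreover have "is_isom a b c r s t m" if "m \<in> set hexagonal_isoms_e3" for m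
    using that unfolding a b t assms(3,4) hexagonal_isoms_e3_def by (auto simp: algebra_simps)
  ultimately have "{m. is_isom a b c r s t m} = set hexagonal_isoms_e3" by blast
  moreover have "card (set hexagonal_isoms_e3) = 12" by code_simp
  ultimately show ?thesis by simp
qed

lemma card_isom_hexagonal_e1:
  assumes "a < b" "b = c" "b = - 2 * r" "s = 0" "t = 0"
  shows "card {m. is_isom a b c r s t m} = 12"
proof -
  define h where "h = - r"
  have h: "h > 0" and b: "b = 2 * h" and c: "c = 2 * h" and r: "r = - h"
    using a_pos assms unfolding h_def by auto
  have "m \<in> set hexagonal_isoms_e1" if isom: "is_isom a b c r s t m" for m
  proof -
    obtain x1 y1 z1 x2 y2 z2 x3 y3 z3 where m: "m = ((x1, y1, z1), (x2, y2, z2), (x3, y3, z3))"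
      by (cases m) auto
    note ent = isom_entries[OF isom[unfolded m]]
    have y3: "y3 \<in> {-1, 0, 1}" using ent(8) assms by simp
    have u0: "y1 = 0" "z1 = 0" using ent(10,11) assms by auto
    have det: "x1 * (y2 * z3 - y3 * z2) = 1" using isom unfolding m u0 by simp
    have x0: "x2 = 0" "x3 = 0"
      using isom a_pos det unfolding m u0 assms(4,5) by auto
    have hc: "h * k = h * l \<longleftrightarrow> k = l" for k l using h by simp
    have "h * (y2 * y2 - y2 * z2 + z2 * z2) = h * 1" "h * (y3 * y3 - y3 * z3 + z3 * z3) = h * 1"
      "h * (2 * y2 * y3 + 2 * z2 * z3 - y2 * z3 - z2 * y3) = h * -1"
      using isom unfolding m u0 x0 b c r assms(4,5) by (simp_all add: algebra_simps)
    note P = hexagonal_isometries[OF ent(5,6) y3 ent(9) this[unfolded hc]]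
    show ?thesis
      using P ent(1) det unfolding m u0 x0 hexagonal_isoms_e1_def
      by (elim insertE emptyE; simp)
  qed
  moreover have "is_isom a b c r s t m" if "m \<in> set hexagonal_isoms_e1" for m
    using that unfolding b c r assms(4,5) hexagonal_isoms_e1_def by (auto simp: algebra_simps)
  ultimately have "{m. is_isom a b c r s t m} = set hexagonal_isoms_e1" by blast
  moreover have "card (set hexagonal_isoms_e1) = 12" by code_simp
  ultimately show ?thesis by simp
qed

end

section \<open>Classification\<close>

theorem theorem1p4:
  fixes a b c r s t :: int and u :: nat
  assumes "positive_definite
    (ternary_form (real_of_int a) (real_of_int b) (real_of_int c)
                  (real_of_int r) (real_of_int s) (real_of_int t))"
    and "eisenstein_reduced a b c r s t"
    and "u = card (Aut_plus (ternary_form a b c r s t))"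
    and "3 dvd u" and "u > 6"
  shows "(u = 12 \<longleftrightarrow>
           (a = b \<and> b = - 2 * t \<and> r = 0 \<and> s = 0) \<or>
           (a \<noteq> b \<and> b = c \<and> c = - 2 * r \<and> s = 0 \<and> t = 0)) \<and>
         (u = 24 \<longleftrightarrow>
           (\<exists>\<kappa> \<in> {2, - 3}. a = b \<and> b = c \<and> c = \<kappa> * r \<and> \<kappa> * r = \<kappa> * s \<and> \<kappa> * s = \<kappa> * t) \<or>
           (a = b \<and> b = c \<and> r = 0 \<and> s = 0 \<and> t = 0))"
proof -
  have a_pos: "a > 0"
  proof -
    have "vector [1, 0, 0] \<noteq> (0 :: real ^ 3)" by (simp add: vec_eq_iff forall_3)
    with assms(1) have "ternary_form (real_of_int a) (real_of_int b) (real_of_int c)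
        (real_of_int r) (real_of_int s) (real_of_int t) (vector [1, 0, 0]) > 0"
      unfolding positive_definite_def by blast
    then show ?thesis by (simp add: ternary_form_def)
  qed
  interpret reduced_form a b c r s t
    using a_pos assms(2) by unfold_locales
  define N where "N = card {m. is_isom a b c r s t m}"
  have u: "u = N" using assms(3) by (simp add: card_Aut_plus N_def del: is_isom.simps)
  have N: "3 dvd N" "N > 6" using assms(4,5) u by simp_all
  have "3 dvd card {m. is_isom a b c r s t m}" "card {m. is_isom a b c r s t m} > 0"
    using N unfolding N_def by linarith+
  from order_three_isom[OF this] obtain m where m: "is_isom a b c r s t m" "order_three m"
    by blast

  have hex3: "N = 12" if "a = b \<and> b = - 2 * t \<and> r = 0 \<and> s = 0"
    using card_isom_hexagonal_e3 that unfolding N_def by simp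
  have hex1: "N = 12" if "a \<noteq> b \<and> b = c \<and> c = - 2 * r \<and> s = 0 \<and> t = 0"
    using card_isom_hexagonal_e1 that basic(1) unfolding N_def by simp
  have primitive: "N = 24" if "a = b \<and> b = c \<and> r = 0 \<and> s = 0 \<and> t = 0"
    using card_isom_cubic(1)[of a] that a_pos unfolding N_def by simp
  have centred: "N = 24"
    if eq: "\<exists>\<kappa> \<in> {2, - 3}. a = b \<and> b = c \<and> c = \<kappa> * r \<and> \<kappa> * r = \<kappa> * s \<and> \<kappa> * s = \<kappa> * t"
  proof -
    have st: "b = a" "c = a" "s = r" "t = r" using eq by auto
    consider "a = 2 * r" | "a = 3 * (- r)" using eq by auto
    then show ?thesis
      using card_isom_cubic(2)[of r] card_isom_cubic(3)[of "- r"] a_pos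
      unfolding N_def st by cases (simp_all del: is_isom.simps)
  qed

  have "a = b \<and> b = - 2 * t \<and> r = 0 \<and> s = 0 \<or>
      a \<noteq> b \<and> b = c \<and> c = - 2 * r \<and> s = 0 \<and> t = 0 \<or>
      (\<exists>\<kappa> \<in> {2, - 3}. a = b \<and> b = c \<and> c = \<kappa> * r \<and> \<kappa> * r = \<kappa> * s \<and> \<kappa> * s = \<kappa> * t) \<or>
      a = b \<and> b = c \<and> r = 0 \<and> s = 0 \<and> t = 0" (is "?H3 \<or> ?H1 \<or> ?C \<or> ?P")
  proof -
    consider "a < b" | "a = b" "b < c" | "a = b" "b = c" using basic(1,2) by linarith
    then show ?thesis
    proof cases
      case 1
      note * = order_three_axis_e1[OF m 1]
      have "\<not> (a = - 3 * s \<and> s = t)"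
      proof
        assume "a = - 3 * s \<and> s = t"
        then have "N \<le> 6"
          unfolding N_def using * 1
          by (intro order_trans[OF card_mono[OF _ isom_rhombohedral_e1_subset]]) simp_all
        then show False using N by simp
      qed
      then show ?thesis using * 1 by auto
    next
      case 2
      note * = order_three_axis_e3[OF m 2]
      have "\<not> (a = 2 * t \<and> r = t \<and> s = t)"
      proof
        assume "a = 2 * t \<and> r = t \<and> s = t"
        then have "N \<le> 6"
          unfolding N_def using 2
          by (intro order_trans[OF card_mono[OF _ isom_rhombohedral_e3_subset]]) simp_all
        then show False using N by simp
      qed
      then show ?thesis using * 2 by auto
    next
      case 3
      consider "r = s \<and> s = t" | "a = - 2 * t \<and> r = 0 \<and> s = 0"
        using order_three_equal_diagonal[OF m 3] by blast
      then show ?thesis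
      proof cases
        case rst: 1
        have "r = 0 \<or> a = 2 * r \<or> a = - 3 * r"
        proof (rule ccontr)
          assume "\<not> ?thesis"
          moreover have "2 * r \<le> a" "- a \<le> 3 * r" using basic(3,8) rst 3 by auto
          ultimately have "N \<le> 6"
            unfolding N_def using rst 3 by (intro card_isom_rhombohedral) auto
          then show False using N by simp
        qed
        then show ?thesis using rst 3 by auto
      next
        case 2
        then show ?thesis using 3 by simp
      qed
    qed
  qed
  moreover have "N = 12 \<Longrightarrow> N \<noteq> 24" by simp
  ultimately show ?thesis
    using hex3 hex1 centred primitive unfolding u by blast
qed

end
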